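(* Let $X\subset\mathbb{R}^n$ be closed, bounded and convex. Let $F(x)=\mathbb{E}[\Phi(x,\xi)]$ be monotone and continuous on $X^\epsilon$, suppose there is $C>0$ with $\mathbb{E}[\|\Phi(x,\xi)\|^2]\le C^2$ for all $x\in X^\epsilon$, and suppose the solution set $X^*$ of VI$(X,F)$ is nonempty. Let $\gamma_k=\gamma_0(k+1)^{-a}$, $\eta_k=\eta_0(k+1)^{-b}$, $\epsilon_k=\epsilon_0(k+1)^{-c}$ with $\gamma_0>0$, $\eta_0\ge0$, $\epsilon_0\ge0$. Let $\xi_0,\xi_1,\dots$ be i.i.d. copies of $\xi$, let $z_0,z_1,\dots$ be independent with $z_k$ uniform on $B_n(0,\epsilon_k)$, and let $x_0$, $(\xi_j)$, $(z_i)$ be mutually independent. Let $\{\bar x_k(r)\}$ be generated by the aRSSA$_r$ algorithm. Then for any $b,c>0$ and any $(a,r)$ with $$(a,r)\in\{(u,v):0<uv\le1,\ v\ge1\}\cup\{(u,v):0<u<1,\ v<1\},$$ we have $\lim_{k\to\infty}\mathbb{E}[\mathrm{G}(\bar x_k(r))]=0$.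
   Context: $\|\cdot\|$ is the Euclidean norm, $B_n(y,\rho)=\{x\in\mathbb{R}^n:\|x-y\|\le\rho\}$, $\Pi_X$ is Euclidean projection onto $X$. $\epsilon\ge0$ is a fixed upper bound of $\{\epsilon_k\}$ and $X^\epsilon=X+B_n(0,\epsilon)$. $\xi$ is an $\mathbb{R}^d$-valued random vector, $\Phi:X^\epsilon\times\mathbb{R}^d\to\mathbb{R}^n$. VI$(X,F)$ asks for $x^*\in X$ with $F(x^* )^T(x-x^* )\ge0$ for all $x\in X$. aRSSA$_r$ algorithm ($r\in\mathbb{R}$): $x_0\in X$ is a random vector with $\mathbb{E}[\|x_0\|^2]<\infty$, and for $k\ge0$, $x_{k+1}=\Pi_X\big(x_k-\gamma_k(\Phi(x_k+z_k,\xi_k)+\eta_kx_k)\big)$, $\ \bar x_{k+1}(r)=\frac{\sum_{t=0}^k\gamma_t^rx_t}{\sum_{t=0}^k\gamma_t^r}$. When $\epsilon_k=0$, $z_k=0$. Gap function: $\mathrm{G}(x)=\sup_{y\in X}F(y)^T(x-y)$ for $x\in X$. *)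

theory Defs
  imports "HOL-Probability.Probability"
begin

text \<open>Minkowski sum of sets, as provided by \<open>HOL-Library.Set_Algebras\<close>.\<close>

definition enlarge :: "(real ^ 'n) set \<Rightarrow> real \<Rightarrow> (real ^ 'n) set" where
  "enlarge X \<epsilon> = X + cball 0 \<epsilon>"

definition monotone_map_on :: "(real ^ 'n) set \<Rightarrow> (real ^ 'n \<Rightarrow> real ^ 'n) \<Rightarrow> bool" where
  "monotone_map_on S F \<longleftrightarrow> (\<forall>x\<in>S. \<forall>y\<in>S. (F x - F y) \<bullet> (x - y) \<ge> 0)"

definition VI_solutions :: "(real ^ 'n) set \<Rightarrow> (real ^ 'n \<Rightarrow> real ^ 'n) \<Rightarrow> (real ^ 'n) set" where
  "VI_solutions X F = {x\<in>X. \<forall>y\<in>X. F x \<bullet> (y - x) \<ge> 0}"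

text \<open>The supremum is taken in the reals, so this is the gap function only if \<open>X\<close> is nonempty
  and the set of values is bounded above (e.g. \<open>X\<close> compact and \<open>F\<close> continuous on \<open>X\<close>).\<close>

definition gap :: "(real ^ 'n) set \<Rightarrow> (real ^ 'n \<Rightarrow> real ^ 'n) \<Rightarrow> real ^ 'n \<Rightarrow> real" where
  "gap X F x = (SUP y\<in>X. F y \<bullet> (x - y))"

text \<open>The average of the first \<open>k\<close> iterates \<open>x 0, \<dots>, x (k - 1)\<close>. The index is shifted so that
  \<open>Suc k\<close> sums over \<open>t \<le> k\<close>; the value at \<open>0\<close> is a dummy.\<close>

definition weighted_avg ::
  "(nat \<Rightarrow> real) \<Rightarrow> real \<Rightarrow> (nat \<Rightarrow> 'w \<Rightarrow> real ^ 'n) \<Rightarrow> nat \<Rightarrow> 'w \<Rightarrow> real ^ 'n" where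
  "weighted_avg \<gamma> r x k \<omega> =
     (\<Sum>t<k. (\<gamma> t powr r) *\<^sub>R x t \<omega>) /\<^sub>R (\<Sum>t<k. \<gamma> t powr r)"

text \<open>The family of events generated by a random element \<open>Y\<close> with values in \<open>N\<close>. It lets
  independence be stated for random elements with values in different types.\<close>

definition generated_events :: "'w measure \<Rightarrow> 'b measure \<Rightarrow> ('w \<Rightarrow> 'b) \<Rightarrow> 'w set set" where
  "generated_events M N Y = {Y -` A \<inter> space M | A. A \<in> sets N}"

text \<open>A sequence of random vectors is treated as one random element of the countable product
  space.\<close>

definition mutually_independent ::
  "'w measure \<Rightarrow> ('w \<Rightarrow> real ^ 'n) \<Rightarrow> (nat \<Rightarrow> 'w \<Rightarrow> real ^ 'd) \<Rightarrow> (nat \<Rightarrow> 'w \<Rightarrow> real ^ 'n) \<Rightarrow> bool" where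
  "mutually_independent M x0 \<xi> z \<longleftrightarrow>
     prob_space.indep_sets M
       (\<lambda>i::nat. [generated_events M borel x0,
             generated_events M (Pi\<^sub>M UNIV (\<lambda>_. borel)) (\<lambda>\<omega> j. \<xi> j \<omega>),
             generated_events M (Pi\<^sub>M UNIV (\<lambda>_. borel)) (\<lambda>\<omega> j. z j \<omega>)] ! i)
       {0, 1, 2}"

end

theory Submission
  imports Defs
begin

text \<open>Write \<open>s\<^sub>t = \<gamma>\<^sub>t\<^sup>r\<close> and let \<open>w\<^sub>t = \<Phi>(x\<^sub>t + z\<^sub>t, \<xi>\<^sub>t) - F(x\<^sub>t + z\<^sub>t)\<close> be the sampling noise. Nonexpansiveness of
  the projection and monotonicity of \<open>F\<close> bound \<open>F(y) \<bullet> (x\<^sub>t - y)\<close> by a telescoping term, terms of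
  order \<open>\<gamma>\<^sub>t + \<eta>\<^sub>t + \<epsilon>\<^sub>t\<close>, and \<open>- w\<^sub>t \<bullet> (x\<^sub>t - y)\<close>. After weighting with \<open>s\<^sub>t\<close> and summing, the noise is affine
  in \<open>y\<close>, so its supremum over \<open>y \<in> X\<close> costs only a multiple of \<open>\<parallel>\<Sum> s\<^sub>t w\<^sub>t\<parallel>\<close>, whose second moment is
  \<open>O(\<Sum> s\<^sub>t\<^sup>2)\<close> because the \<open>w\<^sub>t\<close> are orthogonal martingale differences; \<open>\<Sum> s\<^sub>t (w\<^sub>t \<bullet> x\<^sub>t)\<close> has mean zero.
  Divided by \<open>\<Sum> s\<^sub>t\<close> all error terms vanish, because \<open>\<Sum> s\<^sub>t\<close> diverges and \<open>\<gamma>\<^sub>k\<^sup>r\<^sup>-\<^sup>1 = o(\<Sum>\<^sub>t\<^sub>\<le>\<^sub>k s\<^sub>t)\<close>.\<close>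

subsection \<open>Weighted averages and power step sizes\<close>

text \<open>A Toeplitz-type averaging argument: the finitely many early terms contribute a fixed
  amount \<open>A\<close>, which the divergent total weight absorbs, while the tail of
  \<open>e\<close> is uniformly small.\<close>

lemma weighted_average_tendsto_0:
  fixes s e :: "nat \<Rightarrow> real"
  assumes s: "\<And>t. s t \<ge> 0" and S: "filterlim (\<lambda>k. \<Sum>t<k. s t) at_top sequentially" and e: "e \<longlonglongrightarrow> 0"
  shows "(\<lambda>k. (\<Sum>t<k. s t * e t) / (\<Sum>t<k. s t)) \<longlonglongrightarrow> 0"
proof (rule tendstoI)
  fix \<epsilon> :: real assume \<epsilon>: "\<epsilon> > 0"
  obtain N where N: "\<And>t. t \<ge> N \<Longrightarrow> \<bar>e t\<bar> < \<epsilon> / 2"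
    using LIMSEQ_D[OF e, of "\<epsilon> / 2"] \<epsilon> by auto
  define A where "A = (\<Sum>t<N. s t * \<bar>e t\<bar>)"
  have A: "A \<ge> 0" unfolding A_def using s by (intro sum_nonneg) auto
  \<comment> \<open>This threshold makes \<open>A\<close> smaller than half of
    \<open>\<epsilon>\<close> times the total weight; the tail uses the other half.\<close>
  have "eventually (\<lambda>k. (\<Sum>t<k. s t) > 2 * A / \<epsilon>) sequentially"
    using S by (simp add: filterlim_at_top_dense)
  then show "eventually (\<lambda>k. dist ((\<Sum>t<k. s t * e t) / (\<Sum>t<k. s t)) 0 < \<epsilon>) sequentially"
    using eventually_ge_at_top[of N]
  proof eventually_elim
    case (elim k)
    let ?S = "\<Sum>t<k. s t"
    have S0: "?S > 0" using elim(1) A \<epsilon> by (smt (verit) divide_nonneg_pos)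
    have "\<bar>\<Sum>t<k. s t * e t\<bar> \<le> (\<Sum>t<k. s t * \<bar>e t\<bar>)"
      using sum_abs[of "\<lambda>t. s t * e t" "{..<k}"] s by (simp add: abs_mult)
    also have "(\<Sum>t<k. s t * \<bar>e t\<bar>) = (\<Sum>t\<in>{..<N} \<union> {N..<k}. s t * \<bar>e t\<bar>)"
      using elim(2) by (intro sum.cong) auto
    also have "\<dots> = A + (\<Sum>t\<in>{N..<k}. s t * \<bar>e t\<bar>)"
      unfolding A_def by (intro sum.union_disjoint) auto
    also have "(\<Sum>t\<in>{N..<k}. s t * \<bar>e t\<bar>) \<le> (\<Sum>t\<in>{N..<k}. s t * (\<epsilon> / 2))"
      using N s by (intro sum_mono mult_left_mono) (auto intro: less_imp_le)
    also have "\<dots> \<le> (\<Sum>t<k. s t * (\<epsilon> / 2))"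
      using s \<epsilon> by (intro sum_mono2) auto
    also have "\<dots> = ?S * (\<epsilon> / 2)" by (simp add: sum_distrib_right)
    finally have "\<bar>\<Sum>t<k. s t * e t\<bar> \<le> A + ?S * (\<epsilon> / 2)" by simp
    also have "\<dots> < \<epsilon> * ?S" using elim(1) \<epsilon> by (simp add: field_simps)
    finally show ?case using S0 by (simp add: field_simps)
  qed
qed

text \<open>Partial sums increase, so replacing one factor of the final sum by the partial sum up to
  \<open>t\<close> only enlarges the quotient. What remains is a weighted average of the null
  sequence in \<open>r\<close>. This makes the variance of the averaged noise vanish.\<close>

lemma sum_squares_over_square_sum_tendsto_0:
  fixes s :: "nat \<Rightarrow> real"
  assumes s: "\<And>t. s t > 0" and S: "filterlim (\<lambda>k. \<Sum>t<k. s t) at_top sequentially"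
    and r: "(\<lambda>k. s k / (\<Sum>t<Suc k. s t)) \<longlonglongrightarrow> 0"
  shows "(\<lambda>k. (\<Sum>t<k. (s t)\<^sup>2) / (\<Sum>t<k. s t)\<^sup>2) \<longlonglongrightarrow> 0"
proof (rule Lim_null_comparison)
  show "(\<lambda>k. (\<Sum>t<k. s t * (s t / (\<Sum>i<Suc t. s i))) / (\<Sum>t<k. s t)) \<longlonglongrightarrow> 0"
    using s S r by (intro weighted_average_tendsto_0) (auto intro: less_imp_le)
  show "\<forall>\<^sub>F k in sequentially. norm ((\<Sum>t<k. (s t)\<^sup>2) / (\<Sum>t<k. s t)\<^sup>2)
      \<le> (\<Sum>t<k. s t * (s t / (\<Sum>i<Suc t. s i))) / (\<Sum>t<k. s t)"
  proof (rule always_eventually, rule allI)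
    fix k
    let ?S = "\<lambda>k. \<Sum>t<k. s t"
    have S0: "?S (Suc t) > 0" for t using s by (intro sum_pos) auto
    have Sk: "?S k \<ge> 0" using s by (intro sum_nonneg) (auto intro: less_imp_le)
    have "(\<Sum>t<k. (s t)\<^sup>2) / (?S k)\<^sup>2 = (\<Sum>t<k. s t * (s t / ?S k)) / ?S k"
      by (simp add: power2_eq_square sum_divide_distrib)
    also have "\<dots> \<le> (\<Sum>t<k. s t * (s t / ?S (Suc t))) / ?S k"
    proof (intro divide_right_mono sum_mono mult_left_mono divide_left_mono)
      fix t assume "t \<in> {..<k}"
      then show le: "?S (Suc t) \<le> ?S k" using s by (intro sum_mono2) (auto intro: less_imp_le)
      show "0 < ?S k * ?S (Suc t)" using le S0[of t] by simp
    qed (use s Sk in \<open>auto intro: less_imp_le\<close>)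
    finally show "norm ((\<Sum>t<k. (s t)\<^sup>2) / (?S k)\<^sup>2) \<le> (\<Sum>t<k. s t * (s t / ?S (Suc t))) / ?S k"
      by (simp add: sum_nonneg)
  qed
qed

text \<open>Summation by parts with weights that need not be constant. An increasing
  \<open>c\<close> leaves essentially \<open>D * c k\<close> and a decreasing one
  \<open>D * c 0\<close>; the common bound lets later arguments ignore the direction.\<close>

lemma sum_mult_diff_le_monotone:
  fixes c d :: "nat \<Rightarrow> real"
  assumes c: "\<And>t. c t \<ge> 0" "incseq c \<or> decseq c" and d: "\<And>t. d t \<ge> 0" "\<And>t. d t \<le> D"
  shows "(\<Sum>t<Suc k. c t * (d t - d (Suc t))) \<le> D * (c 0 + c k)"
  using c(2)
proof
  have D: "D \<ge> 0" using d order_trans by blast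
  assume "incseq c"
  \<comment> \<open>The negative last term is kept because the induction step needs it: it combines
    with the next difference.\<close>
  have "(\<Sum>t<Suc k. c t * (d t - d (Suc t))) \<le> c k * D - c k * d (Suc k)"
  proof (induction k)
    case 0
    then show ?case using c(1)[of 0] d[of 0] by (simp add: right_diff_distrib mult_left_mono)
  next
    case (Suc k)
    have "c k * (D - d (Suc k)) \<le> c (Suc k) * (D - d (Suc k))"
      using \<open>incseq c\<close> d by (intro mult_right_mono) (auto simp: incseq_SucD)
    then show ?case using Suc by (simp add: algebra_simps)
  qed
  also have "\<dots> \<le> D * (c 0 + c k)"
    using mult_nonneg_nonneg[OF D c(1)[of 0]] mult_nonneg_nonneg[OF c(1)[of k] d(1)[of "Suc k"]]
    by (simp add: algebra_simps)
  finally show ?thesis .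
next
  have D: "D \<ge> 0" using d order_trans by blast
  assume "decseq c"
  have "(\<Sum>t<Suc k. c t * (d t - d (Suc t))) \<le> c 0 * D - c k * d (Suc k)"
  proof (induction k)
    case 0
    then show ?case using c(1)[of 0] d[of 0] by (simp add: right_diff_distrib mult_left_mono)
  next
    case (Suc k)
    have "c (Suc k) * d (Suc k) \<le> c k * d (Suc k)"
      using \<open>decseq c\<close> d by (intro mult_right_mono) (auto simp: decseq_SucD)
    then show ?case using Suc by (simp add: algebra_simps)
  qed
  also have "\<dots> \<le> D * (c 0 + c k)"
    using mult_nonneg_nonneg[OF D c(1)[of k]] mult_nonneg_nonneg[OF c(1)[of k] d(1)[of "Suc k"]]
    by (simp add: algebra_simps)
  finally show ?thesis .
qed

text \<open>Only the upper half of the indices is used. There \<open>t + 1\<close> lies between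
  \<open>n / 2\<close> and \<open>n\<close>, so each term is comparable to
  \<open>n powr (- p)\<close>; the minimum in the constant covers both signs of \<open>p\<close>.
  For \<open>n = 0\<close> both sides are 0.\<close>

lemma sum_powr_ge:
  fixes p :: real
  shows "(\<Sum>t<n. (real t + 1) powr (- p)) \<ge> min 1 (2 powr p) / 2 * real n powr (1 - p)"
proof (cases "n = 0")
  case False
  have term_ge: "min 1 (2 powr p) * real n powr (- p) \<le> (real t + 1) powr (- p)" if t: "t \<in> {n div 2..<n}" for t
  proof (cases "p \<ge> 0")
    case True
    have "min 1 (2 powr p) * real n powr (- p) \<le> 1 * real n powr (- p)"
      by (intro mult_right_mono) auto
    also have "\<dots> \<le> (real t + 1) powr (- p)"
      using t True by (auto intro!: powr_mono2')
    finally show ?thesis .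
  next
    case p: False
    have "min 1 (2 powr p) * real n powr (- p) \<le> 2 powr p * real n powr (- p)"
      by (intro mult_right_mono) auto
    also have "\<dots> = (real n / 2) powr (- p)"
      using False by (simp add: powr_divide powr_minus field_simps)
    also have "\<dots> \<le> (real t + 1) powr (- p)"
    proof (rule powr_mono2)
      have "n \<le> 2 * (n div 2) + 1" by linarith
      then have "n \<le> 2 * (t + 1)" using t by auto
      then have "real n \<le> real (2 * (t + 1))" by (simp only: of_nat_le_iff)
      then show "real n / 2 \<le> real t + 1" by simp
    qed (use p in auto)
    finally show ?thesis .
  qed
  have n2: "real n / 2 \<le> real (n - n div 2)" by linarith
  have "min 1 (2 powr p) / 2 * real n powr (1 - p) = (real n / 2) * (min 1 (2 powr p) * real n powr (- p))"
    using False by (simp add: powr_diff powr_minus field_simps)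
  also have "\<dots> \<le> real (n - n div 2) * (min 1 (2 powr p) * real n powr (- p))"
    using n2 by (intro mult_right_mono) auto
  also have "\<dots> = (\<Sum>t\<in>{n div 2..<n}. min 1 (2 powr p) * real n powr (- p))"
    by simp
  also have "\<dots> \<le> (\<Sum>t\<in>{n div 2..<n}. (real t + 1) powr (- p))"
    using term_ge by (intro sum_mono)
  also have "\<dots> \<le> (\<Sum>t<n. (real t + 1) powr (- p))"
    by (intro sum_mono2) auto
  finally show ?thesis .
qed simp

section \<open>Asymptotics of power step sizes and of their weighted sums\<close>

lemma powr_neg_tendsto_0:
  fixes a g :: real
  assumes "a > 0"
  shows "(\<lambda>k. g * (real k + 1) powr (- a)) \<longlonglongrightarrow> 0"
proof -
  have "filterlim (\<lambda>k. real k + 1) at_top sequentially"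
    by (intro filterlim_tendsto_add_at_top filterlim_real_sequentially filterlim_at_top_mono[OF filterlim_real_sequentially]) auto
  from tendsto_mult_right_zero[OF tendsto_neg_powr[OF _ this, of "- a"]] show ?thesis using assms by simp
qed

lemma step_size_powr:
  fixes a r g :: real
  assumes "g > 0"
  shows "(g * (real k + 1) powr (- a)) powr r = g powr r * (real k + 1) powr (- (a * r))"
  using assms by (simp add: powr_mult powr_powr)

text \<open>Comparison with the harmonic series: \<open>a * r \<le> 1\<close> makes each term at
  least a constant multiple of \<open>1 / (t + 1)\<close>.\<close>

lemma step_size_sum_at_top:
  fixes a r g :: real
  assumes g: "g > 0" and ar: "a * r \<le> 1"
  shows "filterlim (\<lambda>k. \<Sum>t<k. (g * (real t + 1) powr (- a)) powr r) at_top sequentially"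
proof (rule filterlim_at_top_mono)
  show "filterlim (\<lambda>k. g powr r * harm k) at_top sequentially"
    using g harm_at_top by (intro filterlim_tendsto_pos_mult_at_top[OF tendsto_const]) auto
  have "g powr r * harm k \<le> (\<Sum>t<k. (g * (real t + 1) powr (- a)) powr r)" for k
  proof -
    have "g powr r * harm k = (\<Sum>t<k. g powr r * (real t + 1) powr (- 1))"
      by (simp add: harm_altdef sum_distrib_left powr_minus add.commute)
    also have "\<dots> \<le> (\<Sum>t<k. g powr r * (real t + 1) powr (- (a * r)))"
      using ar by (intro sum_mono mult_left_mono powr_mono) auto
    finally show ?thesis by (simp only: step_size_powr[OF g])
  qed
  then show "\<forall>\<^sub>F k in sequentially. g powr r * harm k \<le> (\<Sum>t<k. (g * (real t + 1) powr (- a)) powr r)"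
    by simp
qed

text \<open>Controls the boundary term left by summation by parts. For \<open>r \<ge> 1\<close> the
  numerator is bounded and divergence of the denominator suffices. For \<open>r < 1\<close> the
  numerator grows like \<open>n powr (a * (1 - r))\<close>, but the denominator is at least of order
  \<open>n powr (1 - a * r)\<close>, so the quotient is of order
  \<open>n powr (a - 1)\<close>.\<close>

lemma step_size_quotient_tendsto_0:
  fixes a r g :: real
  assumes g: "g > 0" and a: "a > 0"
    and ar: "(r \<ge> 1 \<and> a * r \<le> 1) \<or> (r < 1 \<and> a < 1)"
  shows "(\<lambda>k. (g * (real k + 1) powr (- a)) powr (r - 1) / (\<Sum>t<Suc k. (g * (real t + 1) powr (- a)) powr r)) \<longlonglongrightarrow> 0"
    (is "(\<lambda>k. ?c k / ?S (Suc k)) \<longlonglongrightarrow> 0")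
proof -
  have S0: "?S (Suc k) > 0" for k using g by (intro sum_pos) auto
  from ar show ?thesis
  proof
    assume r: "r \<ge> 1 \<and> a * r \<le> 1"
    have "filterlim (\<lambda>k. ?S (Suc k)) at_top sequentially"
      using filterlim_compose[OF step_size_sum_at_top[OF g] filterlim_Suc] r by simp
    then have lim: "(\<lambda>k. g powr (r - 1) / ?S (Suc k)) \<longlonglongrightarrow> 0"
      by (intro real_tendsto_divide_at_top[OF tendsto_const])
    have "norm (?c k / ?S (Suc k)) \<le> g powr (r - 1) / ?S (Suc k)" for k
    proof -
      have "?c k = g powr (r - 1) * (real k + 1) powr (- (a * (r - 1)))" by (rule step_size_powr[OF g])
      also have "\<dots> \<le> g powr (r - 1) * 1"
        using r a powr_mono[of "- (a * (r - 1))" 0 "real k + 1"] by (intro mult_left_mono) auto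
      finally show ?thesis using S0[of k] by (simp add: divide_right_mono)
    qed
    then show ?thesis by (intro Lim_null_comparison[OF _ lim]) simp
  next
    assume r: "r < 1 \<and> a < 1"
    define m where "m = min 1 (2 powr (a * r)) / 2"
    have m: "m > 0" unfolding m_def by auto
    have lim: "(\<lambda>k. 1 / (g * m) * (real k + 1) powr (- (1 - a))) \<longlonglongrightarrow> 0"
      using r by (intro powr_neg_tendsto_0) auto
    have "norm (?c k / ?S (Suc k)) \<le> 1 / (g * m) * (real k + 1) powr (- (1 - a))" for k
    proof -
      define n where "n = real k + 1"
      have n: "n > 0" by (simp add: n_def)
      have "?S (Suc k) = g powr r * (\<Sum>t<Suc k. (real t + 1) powr (- (a * r)))"
        by (simp only: step_size_powr[OF g] sum_distrib_left)
      moreover have "m * n powr (1 - a * r) \<le> (\<Sum>t<Suc k. (real t + 1) powr (- (a * r)))"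
        using sum_powr_ge[of "a * r" "Suc k"] by (simp add: m_def n_def add.commute)
      ultimately have S: "?S (Suc k) \<ge> g powr r * (m * n powr (1 - a * r))"
        using mult_left_mono[of _ _ "g powr r"] by simp
      have "?c k = g powr (r - 1) * n powr (- (a * (r - 1)))"
        unfolding n_def by (rule step_size_powr[OF g])
      then have "?c k / ?S (Suc k) \<le> (g powr (r - 1) * n powr (- (a * (r - 1)))) / (g powr r * (m * n powr (1 - a * r)))"
        using S m g n S0[of k] by (simp only:) (intro divide_left_mono mult_pos_pos; simp)
      also have "\<dots> = (g powr (r - 1) / g powr r) * (n powr (- (a * (r - 1))) / n powr (1 - a * r)) / m"
        by simp
      also have "\<dots> = 1 / (g * m) * n powr (- (1 - a))"
        using g n by (simp add: powr_diff[symmetric] powr_minus algebra_simps divide_simps)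
      finally show ?thesis using S0[of k] by (simp add: n_def)
    qed
    then show ?thesis by (intro Lim_null_comparison[OF _ lim]) simp
  qed
qed

subsection \<open>Projection step and gap function\<close>

text \<open>The point \<open>y\<close> is fixed by the nonexpansive projection, so projecting cannot
  increase the distance to \<open>y\<close>. Expanding the squared distance and dividing by
  \<open>2 * \<gamma>\<close> isolates the inner product.\<close>

lemma projected_step:
  fixes x g y :: "'a::euclidean_space"
  assumes X: "closed X" "convex X" "y \<in> X" and \<gamma>: "\<gamma> > 0"
  shows "g \<bullet> (x - y) \<le> ((norm (x - y))\<^sup>2 - (norm (closest_point X (x - \<gamma> *\<^sub>R g) - y))\<^sup>2) / (2 * \<gamma>)
    + \<gamma> / 2 * (norm g)\<^sup>2"
proof -
  have "norm (closest_point X (x - \<gamma> *\<^sub>R g) - y) \<le> norm ((x - \<gamma> *\<^sub>R g) - y)"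
    using closest_point_lipschitz[of X "x - \<gamma> *\<^sub>R g" y] X closest_point_self[OF X(3)] by (auto simp: dist_norm)
  then have "(norm (closest_point X (x - \<gamma> *\<^sub>R g) - y))\<^sup>2 \<le> (norm ((x - y) - \<gamma> *\<^sub>R g))\<^sup>2"
    by (intro power_mono) (auto simp: algebra_simps)
  also have "\<dots> = (norm (x - y))\<^sup>2 - 2 * \<gamma> * (g \<bullet> (x - y)) + \<gamma>\<^sup>2 * (norm g)\<^sup>2"
    unfolding power2_norm_eq_inner by (simp add: inner_diff inner_commute algebra_simps power2_eq_square)
  finally have "2 * \<gamma> * (g \<bullet> (x - y)) \<le> (norm (x - y))\<^sup>2 - (norm (closest_point X (x - \<gamma> *\<^sub>R g) - y))\<^sup>2
      + \<gamma>\<^sup>2 * (norm g)\<^sup>2" by simp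
  then show ?thesis using \<gamma> by (simp add: field_simps power2_eq_square)
qed

section \<open>Boundedness, sign and regularity of the gap function\<close>

lemma gap_values_bdd_above:
  assumes "\<And>y. y \<in> X \<Longrightarrow> norm y \<le> B" "\<And>y. y \<in> X \<Longrightarrow> norm (F y) \<le> C"
  shows "bdd_above ((\<lambda>y. F y \<bullet> (x - y)) ` X)"
proof (rule bdd_aboveI2)
  fix y assume y: "y \<in> X"
  have "F y \<bullet> (x - y) \<le> norm (F y) * norm (x - y)" by (rule norm_cauchy_schwarz)
  also have "\<dots> \<le> C * (norm x + B)"
    using assms y norm_triangle_ineq4[of x y] order_trans[OF norm_ge_zero assms(2)[OF y]]
    by (intro mult_mono) (auto intro: order_trans add_left_mono)
  finally show "F y \<bullet> (x - y) \<le> C * (norm x + B)" .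
qed

lemma gap_nonneg:
  assumes "bdd_above ((\<lambda>y. F y \<bullet> (x - y)) ` X)" "x \<in> X"
  shows "gap X F x \<ge> 0"
  unfolding gap_def using cSUP_upper[OF assms(2,1)] by simp

text \<open>The gap is a supremum of affine functions whose slopes \<open>F y\<close> have norm at
  most \<open>C\<close>, hence \<open>C\<close>-Lipschitz. Continuity is what makes the gap of a
  random point a random variable.\<close>

lemma continuous_on_gap:
  fixes X :: "(real ^ 'n) set"
  assumes X: "X \<noteq> {}" and B: "\<And>y. y \<in> X \<Longrightarrow> norm y \<le> B" and C: "\<And>y. y \<in> X \<Longrightarrow> norm (F y) \<le> C"
  shows "continuous_on UNIV (gap X F)"
proof -
  have le: "gap X F x \<le> gap X F x' + C * dist x x'" for x x'
    unfolding gap_def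
  proof (rule cSUP_least[OF X])
    fix y assume y: "y \<in> X"
    have "F y \<bullet> (x - y) = F y \<bullet> (x' - y) + F y \<bullet> (x - x')" by (simp add: inner_diff_right)
    also have "F y \<bullet> (x' - y) \<le> (SUP y\<in>X. F y \<bullet> (x' - y))"
      using y gap_values_bdd_above[of X B F C, OF B C] by (intro cSUP_upper) auto
    also have "F y \<bullet> (x - x') \<le> norm (F y) * norm (x - x')" by (rule norm_cauchy_schwarz)
    also have "\<dots> \<le> C * dist x x'" using C[OF y] by (simp add: dist_norm mult_right_mono)
    finally show "F y \<bullet> (x - y) \<le> (SUP y\<in>X. F y \<bullet> (x' - y)) + C * dist x x'" by simp
  qed
  have "C-lipschitz_on UNIV (gap X F)"
  proof (rule lipschitz_onI)
    show "dist (gap X F x) (gap X F x') \<le> C * dist x x'" for x x'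
      using le[of x x'] le[of x' x] by (simp add: dist_real_def dist_commute abs_le_iff)
    show "0 \<le> C" using X C norm_ge_zero order_trans by blast
  qed
  then show ?thesis by (rule lipschitz_on_continuous_on)
qed

subsection \<open>Independence of the past\<close>

text \<open>Independence is stated on events because the past enters as a sigma-algebra
  \<open>G\<close>, not as a random variable with a value type of its own.\<close>

locale indep_subalgebra = prob_space M for M :: "'a measure" +
  fixes G :: "'a measure" and N :: "'b measure" and X :: "'a \<Rightarrow> 'b"
  assumes sub: "subalgebra M G" and X: "X \<in> measurable M N"
    and ind: "\<And>A B. A \<in> sets G \<Longrightarrow> B \<in> sets N \<Longrightarrow>
      prob (A \<inter> (X -` B \<inter> space M)) = prob A * prob (X -` B \<inter> space M)"
begin

lemma measurable_ident_G: "(\<lambda>\<omega>. \<omega>) \<in> measurable M G"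
  using sub by (rule measurable_from_subalg) simp

lemma measurable_Pair_X: "(\<lambda>\<omega>. (\<omega>, X \<omega>)) \<in> measurable M (G \<Otimes>\<^sub>M N)"
  using measurable_ident_G X by (rule measurable_Pair)

text \<open>Independence is exactly the product formula on rectangles, and rectangles determine the
  joint law. Tonelli and Fubini then apply to functions of the past and of \<open>X\<close>.\<close>

lemma distr_pair_indep_subalgebra:
  "restr_to_subalg M G \<Otimes>\<^sub>M distr M N X = distr M (G \<Otimes>\<^sub>M N) (\<lambda>\<omega>. (\<omega>, X \<omega>))"
proof (rule pair_measure_eqI)
  interpret R: prob_space "restr_to_subalg M G"
    using sub prob_space_restr_to_subalg prob_space_axioms by blast
  interpret D: prob_space "distr M N X" using X by (rule prob_space_distr)
  show "sigma_finite_measure (restr_to_subalg M G)" "sigma_finite_measure (distr M N X)"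
    by unfold_locales
  show "sets (restr_to_subalg M G \<Otimes>\<^sub>M distr M N X) = sets (distr M (G \<Otimes>\<^sub>M N) (\<lambda>\<omega>. (\<omega>, X \<omega>)))"
    using sets_restr_to_subalg[OF sub] by (simp cong: sets_pair_measure_cong)
  fix A B assume "A \<in> sets (restr_to_subalg M G)" "B \<in> sets (distr M N X)"
  then have A: "A \<in> sets G" and B: "B \<in> sets N"
    using sets_restr_to_subalg[OF sub] by auto
  have AM: "A \<in> sets M" using A sub by (auto simp: subalgebra_def)
  have eq: "(\<lambda>\<omega>. (\<omega>, X \<omega>)) -` (A \<times> B) \<inter> space M = A \<inter> (X -` B \<inter> space M)"
    using sets.sets_into_space[OF AM] by auto
  have "emeasure (distr M (G \<Otimes>\<^sub>M N) (\<lambda>\<omega>. (\<omega>, X \<omega>))) (A \<times> B) = emeasure M (A \<inter> (X -` B \<inter> space M))"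
    using measurable_Pair_X A B eq by (subst emeasure_distr) auto
  also have "\<dots> = emeasure M A * emeasure M (X -` B \<inter> space M)"
    by (simp add: emeasure_eq_measure ind[OF A B] ennreal_mult)
  finally show "emeasure (restr_to_subalg M G) A * emeasure (distr M N X) B =
      emeasure (distr M (G \<Otimes>\<^sub>M N) (\<lambda>\<omega>. (\<omega>, X \<omega>))) (A \<times> B)"
    using emeasure_restr_to_subalg[OF sub A] emeasure_distr[OF X B] by simp
qed

text \<open>Since \<open>X\<close> is independent of \<open>G\<close>, the conditional expectation of \<open>g \<omega> (X \<omega>)\<close> given \<open>G\<close> is
  obtained by integrating out \<open>X\<close> with \<open>\<omega>\<close> frozen.\<close>

lemma integrable_indep_subalgebra:
  fixes g :: "'a \<Rightarrow> 'b \<Rightarrow> real"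
  assumes g: "(\<lambda>(\<omega>, u). g \<omega> u) \<in> borel_measurable (G \<Otimes>\<^sub>M N)"
    and nonneg: "\<And>\<omega> u. g \<omega> u \<ge> 0"
    and int: "\<And>\<omega>. \<omega> \<in> space M \<Longrightarrow> integrable (distr M N X) (g \<omega>)"
    and le: "\<And>\<omega>. \<omega> \<in> space M \<Longrightarrow> (\<integral>u. g \<omega> u \<partial>distr M N X) \<le> K"
  shows "integrable M (\<lambda>\<omega>. g \<omega> (X \<omega>))" "expectation (\<lambda>\<omega>. g \<omega> (X \<omega>)) \<le> K"
proof -
  let ?R = "restr_to_subalg M G" and ?D = "distr M N X"
  interpret R: prob_space ?R
    using sub prob_space_restr_to_subalg prob_space_axioms by blast
  interpret D: prob_space ?D using X by (rule prob_space_distr)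
  have meas: "(\<lambda>\<omega>. g \<omega> (X \<omega>)) \<in> borel_measurable M"
    using measurable_compose[OF measurable_Pair_X g] by simp
  have gR: "(\<lambda>(\<omega>, u). g \<omega> u) \<in> borel_measurable (?R \<Otimes>\<^sub>M ?D)"
    using g by (simp add: measurable_cong_sets[OF sets_pair_measure_cong[OF sets_restr_to_subalg[OF sub] sets_distr] refl])
  obtain \<omega>0 where \<omega>0: "\<omega>0 \<in> space M" using not_empty by auto
  \<comment> \<open>Needed to return from \<open>ennreal\<close> to the reals, since
    \<open>ennreal\<close> sends negative numbers to 0.\<close>
  have K: "K \<ge> 0" using le[OF \<omega>0] nonneg by (metis Bochner_Integration.integral_nonneg order_trans)
  \<comment> \<open>Nonnegative integrals allow Tonelli here, before joint integrability is
    known.\<close>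
  have "(\<integral>\<^sup>+\<omega>. ennreal (g \<omega> (X \<omega>)) \<partial>M) =
      (\<integral>\<^sup>+p. ennreal (case p of (\<omega>, u) \<Rightarrow> g \<omega> u) \<partial>distr M (G \<Otimes>\<^sub>M N) (\<lambda>\<omega>. (\<omega>, X \<omega>)))"
    using g measurable_Pair_X by (subst nn_integral_distr) (auto intro: measurable_compose[OF _ measurable_ennreal])
  also have "\<dots> = (\<integral>\<^sup>+\<omega>. \<integral>\<^sup>+u. ennreal (g \<omega> u) \<partial>?D \<partial>?R)"
    unfolding distr_pair_indep_subalgebra[symmetric]
    using gR by (subst D.nn_integral_fst[symmetric]) (auto intro: measurable_compose[OF _ measurable_ennreal])
  also have "\<dots> \<le> (\<integral>\<^sup>+\<omega>. ennreal K \<partial>?R)"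
  proof (rule nn_integral_mono)
    fix \<omega> assume "\<omega> \<in> space ?R"
    then have \<omega>: "\<omega> \<in> space M" by (simp add: space_restr_to_subalg)
    show "(\<integral>\<^sup>+u. ennreal (g \<omega> u) \<partial>?D) \<le> ennreal K"
      using nn_integral_eq_integral[OF int[OF \<omega>]] nonneg le[OF \<omega>] by (simp add: ennreal_leI)
  qed
  also have "\<dots> = ennreal K" by (simp add: R.emeasure_space_1)
  finally have *: "(\<integral>\<^sup>+\<omega>. ennreal (g \<omega> (X \<omega>)) \<partial>M) \<le> ennreal K" .
  show i: "integrable M (\<lambda>\<omega>. g \<omega> (X \<omega>))"
    using meas nonneg * by (intro integrableI_nonneg) (auto simp: le_less_trans[OF _ ennreal_less_top])
  show "expectation (\<lambda>\<omega>. g \<omega> (X \<omega>)) \<le> K"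
    using * nn_integral_eq_integral[OF i] nonneg K by simp
qed

text \<open>The version for functions of either sign: with integrability assumed, Fubini gives an
  exact iterated integral, so a vanishing inner integral makes the expectation vanish.\<close>

lemma expectation_indep_subalgebra:
  fixes g :: "'a \<Rightarrow> 'b \<Rightarrow> real"
  assumes g: "(\<lambda>(\<omega>, u). g \<omega> u) \<in> borel_measurable (G \<Otimes>\<^sub>M N)"
    and int: "integrable M (\<lambda>\<omega>. g \<omega> (X \<omega>))"
  shows "expectation (\<lambda>\<omega>. g \<omega> (X \<omega>)) = (\<integral>\<omega>. \<integral>u. g \<omega> u \<partial>distr M N X \<partial>restr_to_subalg M G)"
proof -
  let ?R = "restr_to_subalg M G" and ?D = "distr M N X"
  interpret R: prob_space ?R
    using sub prob_space_restr_to_subalg prob_space_axioms by blast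
  interpret D: prob_space ?D using X by (rule prob_space_distr)
  interpret RD: pair_prob_space ?R ?D by unfold_locales
  note eq = distr_pair_indep_subalgebra
  have "integrable (?R \<Otimes>\<^sub>M ?D) (\<lambda>(\<omega>, u). g \<omega> u)"
    unfolding eq using measurable_Pair_X g int by (subst integrable_distr_eq) auto
  from RD.integral_fst'[OF this] have "(\<integral>\<omega>. \<integral>u. g \<omega> u \<partial>?D \<partial>?R) = (\<integral>p. (case p of (\<omega>, u) \<Rightarrow> g \<omega> u) \<partial>(?R \<Otimes>\<^sub>M ?D))"
    by simp
  also have "\<dots> = expectation (\<lambda>\<omega>. g \<omega> (X \<omega>))"
    unfolding eq using measurable_Pair_X g by (subst integral_distr) auto
  finally show ?thesis by simp
qed

end

text \<open>The whole sequence \<open>z\<close>, future included, is part of the history: \<open>\<xi> t\<close> is independent of it, and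
  it makes \<open>z t\<close> measurable at time \<open>t\<close>.\<close>

definition history ::
  "'w measure \<Rightarrow> ('w \<Rightarrow> real ^ 'n) \<Rightarrow> (nat \<Rightarrow> 'w \<Rightarrow> real ^ 'd) \<Rightarrow> (nat \<Rightarrow> 'w \<Rightarrow> real ^ 'n) \<Rightarrow> nat \<Rightarrow> 'w measure" where
  "history M x0 \<xi> z t = sigma (space M)
     (generated_events M borel x0 \<union> generated_events M (Pi\<^sub>M UNIV (\<lambda>_. borel)) (\<lambda>\<omega> j. z j \<omega>) \<union>
      (\<Union>j<t. generated_events M borel (\<xi> j)))"

section \<open>The history as a filtration, and its independence of the current sample\<close>

lemma generated_events_subset_Pow: "generated_events M N Y \<subseteq> Pow (space M)"
  by (auto simp: generated_events_def)

lemma space_history [simp]: "space (history M x0 \<xi> z t) = space M"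
  and sets_history: "sets (history M x0 \<xi> z t) = sigma_sets (space M)
     (generated_events M borel x0 \<union> generated_events M (Pi\<^sub>M UNIV (\<lambda>_. borel)) (\<lambda>\<omega> j. z j \<omega>) \<union>
      (\<Union>j<t. generated_events M borel (\<xi> j)))"
proof -
  let ?E = "generated_events M borel x0 \<union> generated_events M (Pi\<^sub>M UNIV (\<lambda>_. borel)) (\<lambda>\<omega> j. z j \<omega>) \<union>
    (\<Union>j<t. generated_events M borel (\<xi> j))"
  have "?E \<subseteq> Pow (space M)"
    by (intro Un_least UN_least generated_events_subset_Pow)
  then show "space (history M x0 \<xi> z t) = space M" "sets (history M x0 \<xi> z t) = sigma_sets (space M) ?E"
    unfolding history_def by simp_all
qed

lemma measurable_generated_events:
  assumes "generated_events M N Y \<subseteq> sets G" "space G = space M" "\<And>\<omega>. \<omega> \<in> space M \<Longrightarrow> Y \<omega> \<in> space N"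
  shows "Y \<in> measurable G N"
  using assms by (intro measurableI) (auto simp: generated_events_def)

lemma generators_subset_history:
  "generated_events M borel x0 \<union> generated_events M (Pi\<^sub>M UNIV (\<lambda>_. borel)) (\<lambda>\<omega> j. z j \<omega>) \<union>
      (\<Union>j<t. generated_events M borel (\<xi> j)) \<subseteq> sets (history M x0 \<xi> z t)"
  unfolding sets_history by (rule sigma_sets_superset_generator)

lemma history_measurable:
  shows history_measurable_init: "x0 \<in> borel_measurable (history M x0 \<xi> z t)"
    and history_measurable_z: "z k \<in> borel_measurable (history M x0 \<xi> z t)"
    and history_measurable_\<xi>: "j < t \<Longrightarrow> \<xi> j \<in> borel_measurable (history M x0 \<xi> z t)"
proof -
  note gen = generators_subset_history[of M x0 z \<xi> t]
  show "x0 \<in> borel_measurable (history M x0 \<xi> z t)"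
    using gen by (intro measurable_generated_events[where M = M]) simp_all
  show "\<xi> j \<in> borel_measurable (history M x0 \<xi> z t)" if "j < t"
    using gen that by (intro measurable_generated_events[where M = M]) (simp_all add: UN_subset_iff)
  have "(\<lambda>\<omega> j. z j \<omega>) \<in> measurable (history M x0 \<xi> z t) (Pi\<^sub>M UNIV (\<lambda>_. borel))"
    using gen by (intro measurable_generated_events[where M = M]) (simp_all add: space_PiM)
  from measurable_compose[OF this measurable_component_singleton[OF UNIV_I, of k]]
  show "z k \<in> borel_measurable (history M x0 \<xi> z t)" .
qed

lemma sets_history_mono: "sets (history M x0 \<xi> z t) \<subseteq> sets (history M x0 \<xi> z (Suc t))"
  unfolding sets_history by (intro sigma_sets_mono') fastforce

text \<open>Supplies the pi-system condition for passing from independent generators to the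
  sigma-algebras they generate.\<close>

lemma Int_stable_generated_events: "Int_stable (generated_events M N Y)"
proof (rule Int_stableI)
  fix a b assume "a \<in> generated_events M N Y" "b \<in> generated_events M N Y"
  then obtain A B where "A \<in> sets N" "a = Y -` A \<inter> space M" "B \<in> sets N" "b = Y -` B \<inter> space M"
    by (auto simp: generated_events_def)
  then have "A \<inter> B \<in> sets N" "a \<inter> b = Y -` (A \<inter> B) \<inter> space M" by auto
  then show "a \<inter> b \<in> generated_events M N Y" unfolding generated_events_def by blast
qed

lemma space_in_generated_events:
  "(\<And>\<omega>. \<omega> \<in> space M \<Longrightarrow> Y \<omega> \<in> space N) \<Longrightarrow> space M \<in> generated_events M N Y"
  by (auto simp: generated_events_def intro!: exI[of _ "space N"])

text \<open>Two facts are merged: independence of the three blocks, and independence inside the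
  block of samples. Together they make \<open>x0\<close>, the sequence \<open>z\<close> and all
  single \<open>\<xi> j\<close> one independent family, which is then regrouped into past and
  present.\<close>

lemma (in prob_space) indep_history:
  fixes x0 :: "'a \<Rightarrow> real ^ 'n" and \<xi> :: "nat \<Rightarrow> 'a \<Rightarrow> real ^ 'd" and z :: "nat \<Rightarrow> 'a \<Rightarrow> real ^ 'n"
  assumes indep: "mutually_independent M x0 \<xi> z" and \<xi>: "indep_vars (\<lambda>_. borel) \<xi> UNIV"
  shows "indep_subalgebra M (history M x0 \<xi> z t) borel (\<xi> t)"
proof -
  let ?X = "generated_events M borel x0"
  let ?Z = "generated_events M (Pi\<^sub>M UNIV (\<lambda>_. borel)) (\<lambda>\<omega> j. z j \<omega>)"
  let ?\<Xi> = "generated_events M (Pi\<^sub>M UNIV (\<lambda>_. borel)) (\<lambda>\<omega> j. \<xi> j \<omega>)"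
  have ind3: "indep_sets (\<lambda>i::nat. [?X, ?\<Xi>, ?Z] ! i) {0, 1, 2}"
    using indep unfolding mutually_independent_def .
  have \<xi>_meas: "\<xi> j \<in> borel_measurable M" for j
    using \<xi> by (simp add: indep_vars_def2)
  have ind\<xi>: "indep_sets (\<lambda>j. generated_events M borel (\<xi> j)) UNIV"
    using \<xi> by (simp add: indep_vars_def2 generated_events_def)
  \<comment> \<open>\<open>Inl False\<close> stands for the initial point, \<open>Inl True\<close>
    for the whole sequence \<open>z\<close>, and \<open>Inr j\<close> for the single sample
    \<open>\<xi> j\<close>.\<close>
  define E where "E = (\<lambda>i::bool + nat. case i of Inl s \<Rightarrow> if s then ?Z else ?X
    | Inr j \<Rightarrow> generated_events M borel (\<xi> j))"
  have sub: "?X \<subseteq> events" "?Z \<subseteq> events"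
    using ind3 by (auto simp: indep_sets_def)
  have E_sub: "E i \<subseteq> events" for i
    using sub ind\<xi> by (auto simp: E_def indep_sets_def split: sum.splits if_splits)
  have space_E: "space M \<in> E i" for i
    by (cases i) (auto simp: E_def space_PiM intro!: space_in_generated_events)
  have E: "indep_sets E UNIV"
  proof (rule indep_setsI)
    show "E i \<subseteq> events" for i by (rule E_sub)
    fix A J assume J: "J \<noteq> {}" "finite J" "\<forall>j\<in>J. A j \<in> E j"
    \<comment> \<open>Padding with the sure event lets the three-block formula apply to every
      \<open>J\<close>. Including 0 in \<open>K\<close> avoids an empty intersection, which would be
      the whole type instead of \<open>space M\<close>.\<close>
    define A' where "A' i = (if i \<in> J then A i else space M)" for i
    define K where "K = insert 0 (Inr -` J :: nat set)"
    have A'E: "A' i \<in> E i" for i using J space_E by (simp add: A'_def)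
    have finK: "finite K" unfolding K_def using J by (simp add: finite_vimageI)
    have KJ: "J \<subseteq> insert (Inl False) (insert (Inl True) (Inr ` K))"
    proof
      fix i assume "i \<in> J"
      then show "i \<in> insert (Inl False) (insert (Inl True) (Inr ` K))"
        by (cases i) (auto simp: K_def)
    qed
    let ?L = "insert (Inl False) (insert (Inl True) (Inr ` K))"
    have "\<exists>B. B \<in> sets borel \<and> A' (Inr j) = \<xi> j -` B \<inter> space M" for j
      using A'E[of "Inr j"] by (auto simp: E_def generated_events_def)
    then obtain B where B: "\<And>j. B j \<in> sets borel" "\<And>j. A' (Inr j) = \<xi> j -` B j \<inter> space M"
      by metis
    let ?S = "\<Inter>j\<in>K. A' (Inr j)"
    have K0: "0 \<in> K" by (simp add: K_def)
    \<comment> \<open>A finite intersection of sample events is the preimage of a cylinder, hence an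
      event of the whole-sequence block.\<close>
    have "?S = (\<lambda>\<omega> j. \<xi> j \<omega>) -` (Pi\<^sub>E UNIV (\<lambda>j. if j \<in> K then B j else UNIV)) \<inter> space M"
      using K0 by (auto simp: B PiE_def Pi_def split: if_splits)
    moreover have "Pi\<^sub>E UNIV (\<lambda>j. if j \<in> K then B j else UNIV) \<in> sets (Pi\<^sub>M UNIV (\<lambda>_::nat. borel))"
      using B by (intro sets_PiM_I_countable) auto
    ultimately have S: "?S \<in> ?\<Xi>" unfolding generated_events_def by blast
    have "A' (Inl False) \<in> ?X" "A' (Inl True) \<in> ?Z"
      using A'E[of "Inl False"] A'E[of "Inl True"] by (auto simp: E_def)
    with S have "prob (\<Inter>i\<in>{0, 1, 2::nat}. [A' (Inl False), ?S, A' (Inl True)] ! i)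
        = (\<Prod>i\<in>{0, 1, 2::nat}. prob ([A' (Inl False), ?S, A' (Inl True)] ! i))"
      by (intro indep_setsD[OF ind3]) auto
    then have 1: "prob (A' (Inl False) \<inter> A' (Inl True) \<inter> ?S) =
        prob (A' (Inl False)) * (prob (A' (Inl True)) * prob ?S)"
      by (simp add: numeral_2_eq_2 Int_ac mult_ac)
    have 2: "prob ?S = (\<Prod>j\<in>K. prob (A' (Inr j)))"
      using finK K0 A'E[of "Inr _"] by (intro indep_setsD[OF ind\<xi>]) (auto simp: E_def)
    have 3: "(\<Prod>i\<in>?L. prob (A' i)) = prob (A' (Inl False)) * (prob (A' (Inl True)) * (\<Prod>j\<in>K. prob (A' (Inr j))))"
      using finK by (subst prod.insert; auto simp: prod.reindex image_iff)
    \<comment> \<open>The padded factors are probabilities of the sure event, equal to 1.\<close>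
    have 4: "(\<Prod>i\<in>?L. prob (A' i)) = (\<Prod>j\<in>J. prob (A j))"
      using KJ finK by (intro prod.mono_neutral_cong_right) (auto simp: A'_def prob_space)
    have 5: "A' (Inl False) \<inter> A' (Inl True) \<inter> ?S = (\<Inter>i\<in>?L. A' i)"
      by auto
    obtain i where i: "i \<in> J" using J(1) by auto
    have "A i \<in> events" using J(3) i E_sub by auto
    then have J_space: "(\<Inter>j\<in>J. A j) \<subseteq> space M"
      using INT_lower[OF i, of A] sets.sets_into_space by force
    have A'J: "A' i = A i" if "i \<in> J" for i using that by (simp add: A'_def)
    have 6: "(\<Inter>i\<in>?L. A' i) = (\<Inter>j\<in>J. A j)"
    proof (rule antisym)
      show "(\<Inter>j\<in>J. A j) \<subseteq> (\<Inter>i\<in>?L. A' i)"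
        using J_space by (intro INT_greatest) (auto simp: A'_def)
      show "(\<Inter>i\<in>?L. A' i) \<subseteq> (\<Inter>j\<in>J. A j)"
      proof (rule INT_greatest)
        fix i assume "i \<in> J"
        then show "(\<Inter>i\<in>?L. A' i) \<subseteq> A i" using KJ A'J by (metis INT_lower subsetD)
      qed
    qed
    show "prob (\<Inter>j\<in>J. A j) = (\<Prod>j\<in>J. prob (A j))"
      using 1 2 3 4 by (simp only: 5 6)
  qed
  \<comment> \<open>\<open>True\<close> selects the current sample and \<open>False\<close> the
    generators of the history; these index sets are disjoint.\<close>
  define I where "I s = (if s then {Inr t} else insert (Inl False) (insert (Inl True) (Inr ` {..<t})))"
    for s :: bool
  have "indep_sets (\<lambda>s. sigma_sets (space M) (\<Union>i\<in>I s. E i)) UNIV"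
  proof (rule indep_sets_collect_sigma)
    show "indep_sets E (\<Union>s. I s)" by (rule indep_sets_mono_index[OF _ E]) simp
    show "Int_stable (E i)" for i
      by (cases i) (auto simp: E_def Int_stable_generated_events)
    show "disjoint_family_on I UNIV" by (auto simp: disjoint_family_on_def I_def)
  qed
  note ind_I = this
  have I_False: "(\<Union>i\<in>I False. E i) = ?X \<union> ?Z \<union> (\<Union>j<t. generated_events M borel (\<xi> j))"
    by (auto simp: I_def E_def)
  have I_True: "(\<Union>i\<in>I True. E i) = generated_events M borel (\<xi> t)"
    by (simp add: I_def E_def)
  have ind: "prob (A \<inter> B) = prob A * prob B"
    if A: "A \<in> sets (history M x0 \<xi> z t)" and B: "B \<in> generated_events M borel (\<xi> t)" for A B
  proof -
    have "A \<in> sigma_sets (space M) (\<Union>i\<in>I False. E i)"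
      using A by (simp only: I_False sets_history)
    moreover have "B \<in> sigma_sets (space M) (\<Union>i\<in>I True. E i)"
      unfolding I_True using B by (rule sigma_sets.Basic)
    ultimately have "prob (\<Inter>s\<in>UNIV. if s then B else A) = (\<Prod>s\<in>UNIV. prob (if s then B else A))"
      by (intro indep_setsD[OF ind_I]) simp_all
    then show ?thesis by (simp add: UNIV_bool Int_commute)
  qed
  have "sigma_sets (space M) (?X \<union> ?Z \<union> (\<Union>j<t. generated_events M borel (\<xi> j))) \<subseteq> events"
    using sub ind\<xi> by (intro sets.sigma_sets_subset) (auto simp: indep_sets_def)
  then have sub: "subalgebra M (history M x0 \<xi> z t)"
    by (simp add: subalgebra_def sets_history)
  show ?thesis
  proof (rule indep_subalgebra.intro[OF prob_space_axioms indep_subalgebra_axioms.intro[OF sub \<xi>_meas]])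
    fix A and B :: "(real ^ 'd) set" assume A: "A \<in> sets (history M x0 \<xi> z t)" and "B \<in> sets borel"
    then have "\<xi> t -` B \<inter> space M \<in> generated_events M borel (\<xi> t)"
      unfolding generated_events_def by blast
    with A show "prob (A \<inter> (\<xi> t -` B \<inter> space M)) = prob A * prob (\<xi> t -` B \<inter> space M)"
      by (rule ind)
  qed
qed

subsection \<open>The projected stochastic iteration\<close>

text \<open>The pointwise bound \<open>norm Y \<le> ((norm Y)^2 + K^2) / (2 * K)\<close> yields
  integrability and the sharp constant \<open>K\<close> at once.\<close>

lemma (in prob_space) expectation_norm_le:
  fixes Y :: "'a \<Rightarrow> 'b::euclidean_space"
  assumes Y: "Y \<in> borel_measurable M" and int: "integrable M (\<lambda>\<omega>. (norm (Y \<omega>))\<^sup>2)"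
    and le: "expectation (\<lambda>\<omega>. (norm (Y \<omega>))\<^sup>2) \<le> K\<^sup>2" and K: "K > 0"
  shows "integrable M Y" "expectation (\<lambda>\<omega>. norm (Y \<omega>)) \<le> K"
proof -
  have amgm: "norm (Y \<omega>) \<le> ((norm (Y \<omega>))\<^sup>2 + K\<^sup>2) / (2 * K)" for \<omega>
    using K zero_le_power2[of "norm (Y \<omega>) - K"] by (simp add: field_simps power2_diff power2_eq_square)
  have int': "integrable M (\<lambda>\<omega>. ((norm (Y \<omega>))\<^sup>2 + K\<^sup>2) / (2 * K))" using int by simp
  show Y_int: "integrable M Y"
    using amgm K by (intro Bochner_Integration.integrable_bound[OF int' Y]) auto
  have "expectation (\<lambda>\<omega>. norm (Y \<omega>)) \<le> expectation (\<lambda>\<omega>. ((norm (Y \<omega>))\<^sup>2 + K\<^sup>2) / (2 * K))"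
    using Y_int int' amgm by (intro integral_mono) auto
  also have "\<dots> = (expectation (\<lambda>\<omega>. (norm (Y \<omega>))\<^sup>2) + K\<^sup>2) / (2 * K)"
    using int by (simp add: prob_space)
  also have "\<dots> \<le> K" using le K by (simp add: field_simps power2_eq_square)
  finally show "expectation (\<lambda>\<omega>. norm (Y \<omega>)) \<le> K" .
qed

lemma norm_add_square_le:
  fixes a b :: "'a::real_inner"
  shows "(norm (a + b))\<^sup>2 \<le> 2 * (norm a)\<^sup>2 + 2 * (norm b)\<^sup>2"
proof -
  have "(norm (a + b))\<^sup>2 + (norm (a - b))\<^sup>2 = 2 * (norm a)\<^sup>2 + 2 * (norm b)\<^sup>2"
    unfolding power2_norm_eq_inner by (simp add: inner_add inner_diff inner_commute)
  then show ?thesis using zero_le_power2[of "norm (a - b)"] by linarith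
qed

lemma abs_inner_le_squares:
  fixes a b :: "'a::real_inner"
  shows "\<bar>a \<bullet> b\<bar> \<le> (norm a)\<^sup>2 + (norm b)\<^sup>2"
proof -
  have "\<bar>a \<bullet> b\<bar> \<le> norm a * norm b" by (rule Cauchy_Schwarz_ineq2)
  also have "\<dots> \<le> (norm a)\<^sup>2 + (norm b)\<^sup>2"
    using zero_le_power2[of "norm a - norm b"] mult_nonneg_nonneg[OF norm_ge_zero norm_ge_zero, of a b]
    unfolding power2_diff by linarith
  finally show ?thesis .
qed

text \<open>Separates the convergence argument from the construction of the past and from the power
  form of the steps. \<open>G\<close> is an abstract filtration, \<open>P\<close> the common law of
  the samples, and \<open>E\<close> a set containing all perturbed points.\<close>

locale stochastic_projection = prob_space M for M :: "'w measure" +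
  fixes X E :: "(real ^ 'n) set" and \<Phi> :: "real ^ 'n \<Rightarrow> real ^ 'd \<Rightarrow> real ^ 'n"
    and F :: "real ^ 'n \<Rightarrow> real ^ 'n" and P :: "(real ^ 'd) measure" and \<xi> :: "nat \<Rightarrow> 'w \<Rightarrow> real ^ 'd"
    and x z :: "nat \<Rightarrow> 'w \<Rightarrow> real ^ 'n" and G :: "nat \<Rightarrow> 'w measure"
    and \<gamma> \<eta> eps :: "nat \<Rightarrow> real" and B C :: real
  assumes X: "closed X" "convex X" "X \<noteq> {}" and X_bound: "\<And>y. y \<in> X \<Longrightarrow> norm y \<le> B"
    and X_E: "X \<subseteq> E" and E: "\<And>t y u. y \<in> X \<Longrightarrow> norm u \<le> eps t \<Longrightarrow> y + u \<in> E"
    and F_mono: "monotone_map_on E F" and F_cont: "continuous_on E F"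
    and \<Phi>_meas: "(\<lambda>(y, u). \<Phi> y u) \<in> borel_measurable (restrict_space borel E \<Otimes>\<^sub>M borel)"
    and distr_\<xi>: "\<And>t. distr M borel (\<xi> t) = P"
    and F_eq: "\<And>y. y \<in> E \<Longrightarrow> F y = (\<integral>u. \<Phi> y u \<partial>P)"
    and \<Phi>_int: "\<And>y. y \<in> E \<Longrightarrow> integrable P (\<lambda>u. (norm (\<Phi> y u))\<^sup>2)"
    and \<Phi>_le: "\<And>y. y \<in> E \<Longrightarrow> (\<integral>u. (norm (\<Phi> y u))\<^sup>2 \<partial>P) \<le> C\<^sup>2"
    and C: "C > 0"
    and indep: "\<And>t. indep_subalgebra M (G t) borel (\<xi> t)"
    and G_mono: "\<And>t. sets (G t) \<subseteq> sets (G (Suc t))"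
    and x0_meas: "x 0 \<in> borel_measurable (G 0)"
    and z_meas: "\<And>t. z t \<in> borel_measurable (G t)"
    and \<xi>_meas: "\<And>t. \<xi> t \<in> borel_measurable (G (Suc t))"
    and x0: "\<And>\<omega>. \<omega> \<in> space M \<Longrightarrow> x 0 \<omega> \<in> X"
    and z: "\<And>t \<omega>. \<omega> \<in> space M \<Longrightarrow> norm (z t \<omega>) \<le> eps t"
    and \<gamma>: "\<And>t. \<gamma> t > 0" and \<eta>: "\<And>t. \<eta> t \<ge> 0"
    and step: "\<And>t \<omega>. \<omega> \<in> space M \<Longrightarrow>
      x (Suc t) \<omega> = closest_point X (x t \<omega> - \<gamma> t *\<^sub>R (\<Phi> (x t \<omega> + z t \<omega>) (\<xi> t \<omega>) + \<eta> t *\<^sub>R x t \<omega>))"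
begin

abbreviation v where "v t \<omega> \<equiv> x t \<omega> + z t \<omega>"
abbreviation \<phi> where "\<phi> t \<omega> \<equiv> \<Phi> (v t \<omega>) (\<xi> t \<omega>)"
definition w where "w t \<omega> = \<phi> t \<omega> - F (v t \<omega>)"

section \<open>Feasibility, integrability and adaptedness of the iterates\<close>

lemma sub_G: "subalgebra M (G t)"
  using indep by (rule indep_subalgebra.sub)

lemma space_G: "space (G t) = space M"
  using sub_G by (simp add: subalgebra_def)

lemma sub_G_Suc: "subalgebra (G (Suc t)) (G t)"
  using G_mono by (simp add: subalgebra_def space_G)

lemma prob_space_P: "prob_space P"
  using indep_subalgebra.X[OF indep] prob_space_distr distr_\<xi>[of 0] by metis

lemma sets_P: "sets P = sets borel"
  using distr_\<xi>[of 0] by auto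

lemma x_in_X: "\<omega> \<in> space M \<Longrightarrow> x t \<omega> \<in> X"
  by (cases t) (simp_all add: x0 step closest_point_in_set X)

lemma v_in_E: "\<omega> \<in> space M \<Longrightarrow> v t \<omega> \<in> E"
  using x_in_X z by (rule E)

lemma \<Phi>_section_meas: "y \<in> E \<Longrightarrow> \<Phi> y \<in> borel_measurable P"
proof -
  assume "y \<in> E"
  then have "(\<lambda>u. (y, u)) \<in> measurable borel (restrict_space borel E \<Otimes>\<^sub>M borel)"
    by (intro measurable_Pair1') (simp add: space_restrict_space)
  from measurable_compose[OF this \<Phi>_meas] have "\<Phi> y \<in> borel_measurable borel" by simp
  then show ?thesis using sets_P measurable_cong_sets by blast
qed

lemma \<Phi>_integrable: "y \<in> E \<Longrightarrow> integrable P (\<Phi> y)"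
  by (rule prob_space.expectation_norm_le(1)[OF prob_space_P \<Phi>_section_meas \<Phi>_int \<Phi>_le C])

lemma norm_F_le: "y \<in> E \<Longrightarrow> norm (F y) \<le> C"
  using prob_space.expectation_norm_le(2)[OF prob_space_P \<Phi>_section_meas \<Phi>_int \<Phi>_le C, of y] by (simp add: F_eq order_trans[OF integral_norm_bound])

text \<open>Induction along the filtration: the next iterate depends on \<open>x t\<close>,
  \<open>z t\<close> and \<open>\<xi> t\<close>, all known at time \<open>Suc t\<close>. As
  \<open>\<Phi>\<close> is measurable only over \<open>E\<close>, the perturbed point is tracked as
  a map into the restricted space.\<close>

lemma x_meas: "x t \<in> borel_measurable (G t)"
  and v_meas: "v t \<in> measurable (G t) (restrict_space borel E)"
proof -
  have v: "v t \<in> measurable (G t) (restrict_space borel E)" if "x t \<in> borel_measurable (G t)" for t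
    using that z_meas[of t] v_in_E[of _ t] by (intro measurable_restrict_space2) (auto simp: space_G)
  show x: "x t \<in> borel_measurable (G t)"
  proof (induction t)
    case 0
    then show ?case by (rule x0_meas)
  next
    case (Suc t)
    have [measurable]: "x t \<in> borel_measurable (G (Suc t))"
      using sub_G_Suc Suc by (rule measurable_from_subalg)
    have [measurable]: "v t \<in> measurable (G (Suc t)) (restrict_space borel E)"
      using sub_G_Suc v[OF Suc] by (rule measurable_from_subalg)
    have [measurable]: "\<xi> t \<in> borel_measurable (G (Suc t))" by (rule \<xi>_meas)
    have "(\<lambda>\<omega>. (v t \<omega>, \<xi> t \<omega>)) \<in> measurable (G (Suc t)) (restrict_space borel E \<Otimes>\<^sub>M borel)"
      by measurable
    from measurable_compose[OF this \<Phi>_meas] have [measurable]: "\<phi> t \<in> borel_measurable (G (Suc t))" by simp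
    have "closest_point X \<in> borel_measurable borel"
      using X by (intro borel_measurable_continuous_onI continuous_on_closest_point)
    then have "(\<lambda>\<omega>. closest_point X (x t \<omega> - \<gamma> t *\<^sub>R (\<phi> t \<omega> + \<eta> t *\<^sub>R x t \<omega>))) \<in> borel_measurable (G (Suc t))"
      by (rule measurable_compose[rotated]) measurable
    then show ?case
      by (rule measurable_cong[THEN iffD1, rotated]) (simp add: step space_G)
  qed
  show "v t \<in> measurable (G t) (restrict_space borel E)" by (rule v[OF x])
qed

lemma F_v_meas: "(\<lambda>\<omega>. F (v t \<omega>)) \<in> borel_measurable (G t)"
  using v_meas borel_measurable_continuous_on_restrict[OF F_cont] by (rule measurable_compose)

lemma \<Phi>_v_meas: "(\<lambda>(\<omega>, u). \<Phi> (v t \<omega>) u) \<in> borel_measurable (G t \<Otimes>\<^sub>M borel)"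
proof -
  have "(\<lambda>(\<omega>, u). (v t \<omega>, u)) \<in> measurable (G t \<Otimes>\<^sub>M borel) (restrict_space borel E \<Otimes>\<^sub>M borel)"
    using v_meas[of t] by measurable
  from measurable_compose[OF this \<Phi>_meas] show ?thesis by (simp add: case_prod_unfold)
qed

section \<open>Moments and orthogonality of the sampling noise\<close>

lemma w_meas': "(\<lambda>(\<omega>, u). \<Phi> (v t \<omega>) u - F (v t \<omega>)) \<in> borel_measurable (G t \<Otimes>\<^sub>M borel)"
  using \<Phi>_v_meas[of t] F_v_meas[of t] unfolding case_prod_unfold by measurable

lemma w_meas: "w t \<in> borel_measurable (G (Suc t))"
proof -
  have "(\<lambda>\<omega>. (\<omega>, \<xi> t \<omega>)) \<in> measurable (G (Suc t)) (G t \<Otimes>\<^sub>M borel)"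
    using measurable_from_subalg[OF sub_G_Suc measurable_ident_sets[OF refl]] \<xi>_meas by (rule measurable_Pair)
  from measurable_compose[OF this w_meas'] show ?thesis by (simp add: w_def[abs_def])
qed

text \<open>The random point \<open>v t\<close> is known at time \<open>t\<close> and lies in
  \<open>E\<close>, so freezing it reduces the claim to the uniform second-moment bound.\<close>

lemma \<phi>_square:
  shows \<phi>_square_integrable: "integrable M (\<lambda>\<omega>. (norm (\<phi> t \<omega>))\<^sup>2)"
    and \<phi>_square_le: "expectation (\<lambda>\<omega>. (norm (\<phi> t \<omega>))\<^sup>2) \<le> C\<^sup>2"
proof -
  have m: "(\<lambda>(\<omega>, u). (norm (\<Phi> (v t \<omega>) u))\<^sup>2) \<in> borel_measurable (G t \<Otimes>\<^sub>M borel)"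
    using \<Phi>_v_meas[of t] unfolding case_prod_unfold by measurable
  show "integrable M (\<lambda>\<omega>. (norm (\<phi> t \<omega>))\<^sup>2)" "expectation (\<lambda>\<omega>. (norm (\<phi> t \<omega>))\<^sup>2) \<le> C\<^sup>2"
    using indep_subalgebra.integrable_indep_subalgebra[OF indep m, of "C\<^sup>2"] \<Phi>_int \<Phi>_le v_in_E distr_\<xi> by simp_all
qed

text \<open>Both \<open>\<Phi> y\<close> and its mean \<open>F y\<close> have second moment at most
  \<open>C^2\<close>, so the square of their difference costs
  \<open>2 * C^2 + 2 * C^2\<close>.\<close>

lemma w_square:
  shows w_square_integrable: "integrable M (\<lambda>\<omega>. (norm (w t \<omega>))\<^sup>2)"
    and w_square_le: "expectation (\<lambda>\<omega>. (norm (w t \<omega>))\<^sup>2) \<le> (2 * C)\<^sup>2"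
proof -
  interpret P: prob_space P by (rule prob_space_P)
  have m: "(\<lambda>(\<omega>, u). (norm (\<Phi> (v t \<omega>) u - F (v t \<omega>)))\<^sup>2) \<in> borel_measurable (G t \<Otimes>\<^sub>M borel)"
    using w_meas'[of t] unfolding case_prod_unfold by measurable
  have int: "integrable P (\<lambda>u. (norm (\<Phi> y u - F y))\<^sup>2)"
    and le: "(\<integral>u. (norm (\<Phi> y u - F y))\<^sup>2 \<partial>P) \<le> (2 * C)\<^sup>2" if y: "y \<in> E" for y
  proof -
    have "(norm (F y))\<^sup>2 \<le> C\<^sup>2" using norm_F_le[OF y] by (intro power_mono) auto
    then have bound: "(norm (\<Phi> y u - F y))\<^sup>2 \<le> 2 * (norm (\<Phi> y u))\<^sup>2 + 2 * C\<^sup>2" for u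
      using norm_add_square_le[of "\<Phi> y u" "- F y"] by simp
    have int': "integrable P (\<lambda>u. 2 * (norm (\<Phi> y u))\<^sup>2 + 2 * C\<^sup>2)" using \<Phi>_int[OF y] by simp
    show int: "integrable P (\<lambda>u. (norm (\<Phi> y u - F y))\<^sup>2)"
      using bound \<Phi>_section_meas[OF y] by (intro Bochner_Integration.integrable_bound[OF int']) (auto intro: order_trans)
    have "(\<integral>u. (norm (\<Phi> y u - F y))\<^sup>2 \<partial>P) \<le> (\<integral>u. 2 * (norm (\<Phi> y u))\<^sup>2 + 2 * C\<^sup>2 \<partial>P)"
      using int int' bound by (intro integral_mono)
    also have "\<dots> = 2 * (\<integral>u. (norm (\<Phi> y u))\<^sup>2 \<partial>P) + 2 * C\<^sup>2"
      using \<Phi>_int[OF y] by (simp add: P.prob_space)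
    also have "\<dots> \<le> (2 * C)\<^sup>2" using \<Phi>_le[OF y] by (simp add: power_mult_distrib)
    finally show "(\<integral>u. (norm (\<Phi> y u - F y))\<^sup>2 \<partial>P) \<le> (2 * C)\<^sup>2" .
  qed
  show "integrable M (\<lambda>\<omega>. (norm (w t \<omega>))\<^sup>2)" "expectation (\<lambda>\<omega>. (norm (w t \<omega>))\<^sup>2) \<le> (2 * C)\<^sup>2"
    using indep_subalgebra.integrable_indep_subalgebra[OF indep m, of "(2 * C)\<^sup>2"] int le v_in_E distr_\<xi>
    by (simp_all add: w_def)
qed

text \<open>With the past frozen, \<open>\<Phi>\<close> averages to \<open>F\<close>, so the inner
  integral is 0. Later \<open>H\<close> is either a sum of earlier noise or the current
  iterate.\<close>

lemma w_orthogonal: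
  assumes H: "H \<in> borel_measurable (G t)" and H2: "integrable M (\<lambda>\<omega>. (norm (H \<omega>))\<^sup>2)"
  shows "integrable M (\<lambda>\<omega>. w t \<omega> \<bullet> H \<omega>)" "expectation (\<lambda>\<omega>. w t \<omega> \<bullet> H \<omega>) = 0"
proof -
  interpret P: prob_space P by (rule prob_space_P)
  have [measurable]: "H \<in> borel_measurable M" "w t \<in> borel_measurable M"
    using measurable_from_subalg[OF sub_G] H w_meas by blast+
  show int: "integrable M (\<lambda>\<omega>. w t \<omega> \<bullet> H \<omega>)"
    using abs_inner_le_squares
    by (intro Bochner_Integration.integrable_bound[OF Bochner_Integration.integrable_add[OF w_square_integrable[of t] H2]])
      (auto intro: order_trans)
  have m: "(\<lambda>(\<omega>, u). (\<Phi> (v t \<omega>) u - F (v t \<omega>)) \<bullet> H \<omega>) \<in> borel_measurable (G t \<Otimes>\<^sub>M borel)"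
    using w_meas'[of t] H unfolding case_prod_unfold by measurable
  have "expectation (\<lambda>\<omega>. w t \<omega> \<bullet> H \<omega>) =
      (\<integral>\<omega>. \<integral>u. (\<Phi> (v t \<omega>) u - F (v t \<omega>)) \<bullet> H \<omega> \<partial>P \<partial>restr_to_subalg M (G t))"
    using indep_subalgebra.expectation_indep_subalgebra[OF indep m] int by (simp add: distr_\<xi> w_def)
  also have "\<dots> = (\<integral>\<omega>. 0 \<partial>restr_to_subalg M (G t))"
  proof (rule Bochner_Integration.integral_cong[OF refl])
    fix \<omega> assume "\<omega> \<in> space (restr_to_subalg M (G t))"
    then have "v t \<omega> \<in> E" by (simp add: space_restr_to_subalg v_in_E)
    then show "(\<integral>u. (\<Phi> (v t \<omega>) u - F (v t \<omega>)) \<bullet> H \<omega> \<partial>P) = 0"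
      using \<Phi>_integrable by (simp add: F_eq P.prob_space)
  qed
  finally show "expectation (\<lambda>\<omega>. w t \<omega> \<bullet> H \<omega>) = 0" by simp
qed

text \<open>Orthogonality removes the cross terms, so second moments add. Measurability belongs to
  the same induction because the partial sum takes the role of \<open>H\<close>.\<close>

lemma w_sum:
  fixes s :: "nat \<Rightarrow> real"
  shows w_sum_meas: "(\<lambda>\<omega>. \<Sum>t<k. s t *\<^sub>R w t \<omega>) \<in> borel_measurable (G k)"
    and w_sum_square_integrable: "integrable M (\<lambda>\<omega>. (norm (\<Sum>t<k. s t *\<^sub>R w t \<omega>))\<^sup>2)"
    and w_sum_square_le: "expectation (\<lambda>\<omega>. (norm (\<Sum>t<k. s t *\<^sub>R w t \<omega>))\<^sup>2) \<le> (2 * C)\<^sup>2 * (\<Sum>t<k. (s t)\<^sup>2)"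
proof (induction k)
  case 0
  show "(\<lambda>\<omega>. \<Sum>t<0. s t *\<^sub>R w t \<omega>) \<in> borel_measurable (G 0)"
    "integrable M (\<lambda>\<omega>. (norm (\<Sum>t<0. s t *\<^sub>R w t \<omega>))\<^sup>2)"
    "expectation (\<lambda>\<omega>. (norm (\<Sum>t<0. s t *\<^sub>R w t \<omega>))\<^sup>2) \<le> (2 * C)\<^sup>2 * (\<Sum>t<0. (s t)\<^sup>2)"
    by simp_all
next
  case (Suc k)
  let ?W = "\<lambda>k \<omega>. \<Sum>t<k. s t *\<^sub>R w t \<omega>"
  have "?W k \<in> borel_measurable (G (Suc k))"
    using sub_G_Suc Suc(1) by (rule measurable_from_subalg)
  then show "?W (Suc k) \<in> borel_measurable (G (Suc k))"
    using w_meas[of k] by simp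
  have eq: "(norm (?W (Suc k) \<omega>))\<^sup>2 =
      (norm (?W k \<omega>))\<^sup>2 + (2 * s k) * (w k \<omega> \<bullet> ?W k \<omega>) + (s k)\<^sup>2 * (norm (w k \<omega>))\<^sup>2" for \<omega>
    unfolding power2_norm_eq_inner sum.lessThan_Suc
    by (simp add: inner_add inner_commute power2_eq_square del: inner_sum_left inner_sum_right)
  note orth = w_orthogonal[OF Suc(1,2)]
  show "integrable M (\<lambda>\<omega>. (norm (?W (Suc k) \<omega>))\<^sup>2)"
    unfolding eq using Suc(2) orth(1) w_square_integrable[of k] by simp
  have "expectation (\<lambda>\<omega>. (norm (?W (Suc k) \<omega>))\<^sup>2) =
      expectation (\<lambda>\<omega>. (norm (?W k \<omega>))\<^sup>2) + (s k)\<^sup>2 * expectation (\<lambda>\<omega>. (norm (w k \<omega>))\<^sup>2)"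
    unfolding eq using Suc(2) orth w_square_integrable[of k] by simp
  also have "\<dots> \<le> (2 * C)\<^sup>2 * (\<Sum>t<k. (s t)\<^sup>2) + (s k)\<^sup>2 * (2 * C)\<^sup>2"
    using Suc(3) w_square_le[of k] by (intro add_mono mult_left_mono) auto
  finally show "expectation (\<lambda>\<omega>. (norm (?W (Suc k) \<omega>))\<^sup>2) \<le> (2 * C)\<^sup>2 * (\<Sum>t<Suc k. (s t)\<^sup>2)"
    by (simp add: algebra_simps)
qed

section \<open>Regret along a path and the expected gap\<close>

lemma B_nonneg: "B \<ge> 0"
  using X(3) X_bound norm_ge_zero order_trans by blast

text \<open>Monotonicity replaces \<open>F y\<close> by \<open>F\<close> at the perturbed point.
  That vector is the search direction minus regularization and noise; the projection inequality
  treats the direction, and boundedness of \<open>X\<close> the regularization.\<close>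

lemma step_inequality:
  assumes \<omega>: "\<omega> \<in> space M" and y: "y \<in> X"
  shows "F y \<bullet> (x t \<omega> - y) \<le> ((norm (x t \<omega> - y))\<^sup>2 - (norm (x (Suc t) \<omega> - y))\<^sup>2) / (2 * \<gamma> t)
     + \<gamma> t * ((norm (\<phi> t \<omega>))\<^sup>2 + (\<eta> t)\<^sup>2 * B\<^sup>2) + (2 * C * eps t + 2 * B\<^sup>2 * \<eta> t) - w t \<omega> \<bullet> (x t \<omega> - y)"
proof -
  let ?x = "x t \<omega>" and ?v = "v t \<omega>" and ?z = "z t \<omega>" and ?g = "\<phi> t \<omega> + \<eta> t *\<^sub>R x t \<omega>"
  have xX: "?x \<in> X" and vE: "?v \<in> E" and yE: "y \<in> E" using \<omega> y x_in_X v_in_E X_E by auto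
  have xB: "norm ?x \<le> B" and yB: "norm y \<le> B" using X_bound xX y by auto
  have z_le: "norm ?z \<le> eps t" using z[OF \<omega>] .
  have Cz: "\<bar>F u \<bullet> ?z\<bar> \<le> C * eps t" if "u \<in> E" for u
    using Cauchy_Schwarz_ineq2[of "F u" ?z] mult_mono[OF norm_F_le[OF that] z_le] C by simp
  have "(F ?v - F y) \<bullet> (?v - y) \<ge> 0" using F_mono vE yE by (simp add: monotone_map_on_def)
  \<comment> \<open>Monotonicity concerns \<open>?v - y = (?x - y) + ?z\<close>; removing
    \<open>?z\<close> costs \<open>C * eps t\<close> for each of the two values of
    \<open>F\<close>.\<close>
  then have 1: "F y \<bullet> (?x - y) \<le> F ?v \<bullet> (?x - y) + 2 * C * eps t"
    using Cz[OF vE] Cz[OF yE] by (simp add: inner_diff inner_add algebra_simps abs_le_iff)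
  have "norm (?x - y) \<le> 2 * B" using norm_triangle_ineq4[of ?x y] xB yB by simp
  then have "\<bar>?x \<bullet> (?x - y)\<bar> \<le> B * (2 * B)"
    using Cauchy_Schwarz_ineq2[of ?x "?x - y"] mult_mono[OF xB, of "norm (?x - y)" "2 * B"] B_nonneg by simp
  then have "\<eta> t * (- (?x \<bullet> (?x - y))) \<le> \<eta> t * (B * (2 * B))"
    using \<eta> by (intro mult_left_mono) auto
  then have 2: "- (\<eta> t * (?x \<bullet> (?x - y))) \<le> 2 * B\<^sup>2 * \<eta> t" by (simp add: power2_eq_square algebra_simps)
  have "(norm (\<eta> t *\<^sub>R ?x))\<^sup>2 \<le> (\<eta> t)\<^sup>2 * B\<^sup>2"
    using power_mono[OF xB, of 2] by (simp add: power_mult_distrib mult_left_mono)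
  then have "(norm ?g)\<^sup>2 \<le> 2 * ((norm (\<phi> t \<omega>))\<^sup>2 + (\<eta> t)\<^sup>2 * B\<^sup>2)"
    using norm_add_square_le[of "\<phi> t \<omega>" "\<eta> t *\<^sub>R ?x"] by simp
  then have 3: "\<gamma> t / 2 * (norm ?g)\<^sup>2 \<le> \<gamma> t * ((norm (\<phi> t \<omega>))\<^sup>2 + (\<eta> t)\<^sup>2 * B\<^sup>2)"
    using mult_left_mono[of _ _ "\<gamma> t / 2"] \<gamma>[of t] by fastforce
  have "F ?v \<bullet> (?x - y) = ?g \<bullet> (?x - y) - \<eta> t * (?x \<bullet> (?x - y)) - w t \<omega> \<bullet> (?x - y)"
    by (simp add: w_def inner_diff_left inner_add_left)
  moreover have "?g \<bullet> (?x - y) \<le> ((norm (?x - y))\<^sup>2 - (norm (x (Suc t) \<omega> - y))\<^sup>2) / (2 * \<gamma> t) + \<gamma> t / 2 * (norm ?g)\<^sup>2"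
    unfolding step[OF \<omega>] using X y \<gamma> by (intro projected_step)
  ultimately show ?thesis using 1 2 3 by linarith
qed

text \<open>Only the squared distances and one linear noise term involve \<open>y\<close>, and both
  are bounded uniformly over \<open>X\<close>. The right-hand side is free of \<open>y\<close>, so
  the supremum can be taken before the expectation.\<close>

lemma weighted_regret:
  fixes s :: "nat \<Rightarrow> real"
  assumes \<omega>: "\<omega> \<in> space M" and y: "y \<in> X" and s: "\<And>t. s t > 0"
    and c: "incseq (\<lambda>t. s t / \<gamma> t) \<or> decseq (\<lambda>t. s t / \<gamma> t)"
  shows "(\<Sum>t<Suc k. s t * (F y \<bullet> (x t \<omega> - y))) \<le> 2 * B\<^sup>2 * (s 0 / \<gamma> 0 + s k / \<gamma> k)
    + (\<Sum>t<Suc k. s t * (\<gamma> t * ((norm (\<phi> t \<omega>))\<^sup>2 + (\<eta> t)\<^sup>2 * B\<^sup>2) + (2 * C * eps t + 2 * B\<^sup>2 * \<eta> t)))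
    - (\<Sum>t<Suc k. s t * (w t \<omega> \<bullet> x t \<omega>)) + B * norm (\<Sum>t<Suc k. s t *\<^sub>R w t \<omega>)"
proof -
  let ?d = "\<lambda>t. (norm (x t \<omega> - y))\<^sup>2"
  let ?q = "\<lambda>t. \<gamma> t * ((norm (\<phi> t \<omega>))\<^sup>2 + (\<eta> t)\<^sup>2 * B\<^sup>2) + (2 * C * eps t + 2 * B\<^sup>2 * \<eta> t)"
  let ?W = "\<Sum>t<Suc k. s t *\<^sub>R w t \<omega>"
  have "(\<Sum>t<Suc k. s t * (F y \<bullet> (x t \<omega> - y))) \<le>
      (\<Sum>t<Suc k. (s t / \<gamma> t * (?d t - ?d (Suc t))) / 2 + s t * ?q t - s t * (w t \<omega> \<bullet> x t \<omega>) + (s t *\<^sub>R w t \<omega>) \<bullet> y)"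
  proof (rule sum_mono)
    fix t
    have "s t * (F y \<bullet> (x t \<omega> - y)) \<le> s t * ((?d t - ?d (Suc t)) / (2 * \<gamma> t) + ?q t - w t \<omega> \<bullet> (x t \<omega> - y))"
      using step_inequality[OF \<omega> y, of t] s[of t] by (intro mult_left_mono) auto
    also have "\<dots> = (s t / \<gamma> t * (?d t - ?d (Suc t))) / 2 + s t * ?q t - s t * (w t \<omega> \<bullet> x t \<omega>) + (s t *\<^sub>R w t \<omega>) \<bullet> y"
      using \<gamma>[of t] by (simp add: inner_diff_right field_simps)
    finally show "s t * (F y \<bullet> (x t \<omega> - y)) \<le> \<dots>" .
  qed
  also have "\<dots> = (\<Sum>t<Suc k. s t / \<gamma> t * (?d t - ?d (Suc t))) / 2 + (\<Sum>t<Suc k. s t * ?q t)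
      - (\<Sum>t<Suc k. s t * (w t \<omega> \<bullet> x t \<omega>)) + ?W \<bullet> y"
    by (simp only: sum.distrib sum_subtractf inner_sum_left sum_divide_distrib)
  \<comment> \<open>Points of \<open>X\<close> are at most \<open>2 * B\<close> apart; the division
    by 2 outside the sum turns \<open>(2 * B)^2\<close> into \<open>2 * B^2\<close>.\<close>
  also have "(\<Sum>t<Suc k. s t / \<gamma> t * (?d t - ?d (Suc t))) \<le> (2 * B)\<^sup>2 * (s 0 / \<gamma> 0 + s k / \<gamma> k)"
  proof (rule sum_mult_diff_le_monotone[OF _ c])
    show "s t / \<gamma> t \<ge> 0" for t using s[of t] \<gamma>[of t] by simp
    show "?d t \<le> (2 * B)\<^sup>2" for t
      using norm_triangle_ineq4[of "x t \<omega>" y] X_bound[OF y] X_bound[OF x_in_X[OF \<omega>]]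
      by (intro power_mono) (smt (verit), simp)
  qed simp
  also have "?W \<bullet> y \<le> B * norm ?W"
    using norm_cauchy_schwarz[of ?W y] mult_left_mono[OF X_bound[OF y] norm_ge_zero[of ?W]] by (simp add: mult.commute)
  finally show ?thesis by (simp add: power_mult_distrib)
qed

text \<open>For fixed \<open>y\<close> the gap value is affine in its point, so the regret bound
  divided by the total weight bounds the gap of the average. In expectation the noise paired with
  the iterates drops out, and the norm of the noise sum is controlled by its second moment.\<close>

lemma gap_avg:
  fixes r :: real and k :: nat
  defines "s \<equiv> \<lambda>t. \<gamma> t powr r"
  assumes c: "incseq (\<lambda>t. s t / \<gamma> t) \<or> decseq (\<lambda>t. s t / \<gamma> t)"
  shows gap_avg_integrable: "integrable M (\<lambda>\<omega>. gap X F (weighted_avg \<gamma> r x (Suc k) \<omega>))"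
    and gap_avg_nonneg: "expectation (\<lambda>\<omega>. gap X F (weighted_avg \<gamma> r x (Suc k) \<omega>)) \<ge> 0"
    and gap_avg_le: "expectation (\<lambda>\<omega>. gap X F (weighted_avg \<gamma> r x (Suc k) \<omega>)) \<le>
      (2 * B\<^sup>2 * (s 0 / \<gamma> 0 + s k / \<gamma> k)
      + (\<Sum>t<Suc k. s t * (\<gamma> t * (C\<^sup>2 + (\<eta> t)\<^sup>2 * B\<^sup>2) + (2 * C * eps t + 2 * B\<^sup>2 * \<eta> t)))
      + 2 * B * C * sqrt (\<Sum>t<Suc k. (s t)\<^sup>2)) / (\<Sum>t<Suc k. s t)"
proof -
  let ?xb = "weighted_avg \<gamma> r x (Suc k)"
  let ?S = "\<Sum>t<Suc k. s t" and ?W = "\<lambda>\<omega>. \<Sum>t<Suc k. s t *\<^sub>R w t \<omega>"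
  have s: "s t > 0" for t unfolding s_def using \<gamma>[of t] by simp
  have S: "?S > 0" using s by (intro sum_pos) auto
  have norm_F: "\<And>y. y \<in> X \<Longrightarrow> norm (F y) \<le> C" using norm_F_le X_E by auto
  note bdd = gap_values_bdd_above[of X B F C, OF X_bound norm_F]
  have [measurable]: "x t \<in> borel_measurable M" "w t \<in> borel_measurable M" for t
    using measurable_from_subalg[OF sub_G] x_meas w_meas by blast+
  have xb_meas: "?xb \<in> borel_measurable M"
    unfolding weighted_avg_def[abs_def] by measurable
  have "gap X F \<in> borel_measurable borel"
    using continuous_on_gap[OF X(3) X_bound norm_F] by (intro borel_measurable_continuous_onI)
  then have gap_meas: "(\<lambda>\<omega>. gap X F (?xb \<omega>)) \<in> borel_measurable M"
    using xb_meas by (rule measurable_compose[rotated])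
  have xb: "?xb \<omega> = (\<Sum>t<Suc k. s t *\<^sub>R x t \<omega>) /\<^sub>R ?S" for \<omega>
    by (simp add: weighted_avg_def s_def)
  \<comment> \<open>The average is a convex combination of points of \<open>X\<close>, so its gap is
    nonnegative; integrability then follows by domination.\<close>
  have xb_X: "?xb \<omega> \<in> X" if "\<omega> \<in> space M" for \<omega>
  proof -
    have "(\<Sum>t<Suc k. (s t / ?S) *\<^sub>R x t \<omega>) \<in> X"
      using X(2) x_in_X[OF that] S s by (intro convex_sum) (auto simp: sum_divide_distrib[symmetric] intro: less_imp_le)
    also have "(\<Sum>t<Suc k. (s t / ?S) *\<^sub>R x t \<omega>) = ?xb \<omega>"
      by (simp add: xb scaleR_sum_right divide_inverse mult.commute del: sum.lessThan_Suc)
    finally show ?thesis .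
  qed
  have nonneg: "gap X F (?xb \<omega>) \<ge> 0" if "\<omega> \<in> space M" for \<omega>
    using xb_X[OF that] bdd by (intro gap_nonneg)
  define q where "q t \<omega> = \<gamma> t * ((norm (\<phi> t \<omega>))\<^sup>2 + (\<eta> t)\<^sup>2 * B\<^sup>2) + (2 * C * eps t + 2 * B\<^sup>2 * \<eta> t)" for t \<omega>
  define R where "R \<omega> = 2 * B\<^sup>2 * (s 0 / \<gamma> 0 + s k / \<gamma> k) + (\<Sum>t<Suc k. s t * q t \<omega>)
    - (\<Sum>t<Suc k. s t * (w t \<omega> \<bullet> x t \<omega>)) + B * norm (?W \<omega>)" for \<omega>
  have le: "gap X F (?xb \<omega>) \<le> R \<omega> / ?S" if \<omega>: "\<omega> \<in> space M" for \<omega>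
    unfolding gap_def
  proof (rule cSUP_least[OF X(3)])
    fix y assume y: "y \<in> X"
    have "?S * (F y \<bullet> (?xb \<omega> - y)) = F y \<bullet> ((?S *\<^sub>R ?xb \<omega>) - ?S *\<^sub>R y)"
      by (simp only: inner_scaleR_right[symmetric] scaleR_diff_right)
    also have "?S *\<^sub>R ?xb \<omega> = (\<Sum>t<Suc k. s t *\<^sub>R x t \<omega>)"
      using S by (simp add: xb del: sum.lessThan_Suc)
    also have "F y \<bullet> ((\<Sum>t<Suc k. s t *\<^sub>R x t \<omega>) - ?S *\<^sub>R y) = (\<Sum>t<Suc k. s t * (F y \<bullet> (x t \<omega> - y)))"
      by (simp only: scaleR_sum_left sum_subtractf[symmetric] inner_sum_right inner_scaleR_right
          scaleR_diff_right[symmetric])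
    also have "\<dots> \<le> R \<omega>"
      unfolding R_def q_def using \<omega> y s c by (rule weighted_regret)
    finally show "F y \<bullet> (?xb \<omega> - y) \<le> R \<omega> / ?S" using S by (simp add: field_simps)
  qed
  have x2: "integrable M (\<lambda>\<omega>. (norm (x t \<omega>))\<^sup>2)" for t
  proof (rule integrable_const_bound[where B = "B\<^sup>2"])
    show "AE \<omega> in M. norm ((norm (x t \<omega>))\<^sup>2) \<le> B\<^sup>2"
      using X_bound x_in_X by (intro AE_I2) (auto intro: power_mono)
  qed measurable
  note orth = w_orthogonal[OF x_meas x2]
  have q_int: "integrable M (q t)" for t
    unfolding q_def using \<phi>_square_integrable[of t] by simp
  have q_le: "expectation (q t) \<le> \<gamma> t * (C\<^sup>2 + (\<eta> t)\<^sup>2 * B\<^sup>2) + (2 * C * eps t + 2 * B\<^sup>2 * \<eta> t)" for t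
  proof -
    have "expectation (q t) = \<gamma> t * (expectation (\<lambda>\<omega>. (norm (\<phi> t \<omega>))\<^sup>2) + (\<eta> t)\<^sup>2 * B\<^sup>2) + (2 * C * eps t + 2 * B\<^sup>2 * \<eta> t)"
      unfolding q_def using \<phi>_square_integrable[of t] by (simp add: prob_space)
    then show ?thesis using \<phi>_square_le[of t] \<gamma>[of t] by (simp add: mult_left_mono)
  qed
  \<comment> \<open>The root of the second-moment bound for the weighted noise sum; it is positive
    because all weights are.\<close>
  let ?K = "2 * C * sqrt (\<Sum>t<Suc k. (s t)\<^sup>2)"
  have s2: "(\<Sum>t<Suc k. (s t)\<^sup>2) > 0" using s by (intro sum_pos zero_less_power) auto
  then have "expectation (\<lambda>\<omega>. (norm (?W \<omega>))\<^sup>2) \<le> ?K\<^sup>2"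
    using w_sum_square_le[of s "Suc k"] by (simp add: power_mult_distrib del: sum.lessThan_Suc)
  moreover have "?W \<in> borel_measurable M" by measurable
  moreover have "?K > 0" using s2 C by simp
  ultimately have W_int: "integrable M ?W" and W_le: "expectation (\<lambda>\<omega>. norm (?W \<omega>)) \<le> ?K"
    using expectation_norm_le[of ?W ?K] w_sum_square_integrable[of s "Suc k"] by blast+
  have i1: "integrable M (\<lambda>\<omega>. \<Sum>t<Suc k. s t * q t \<omega>)"
    using q_int by (intro Bochner_Integration.integrable_sum integrable_mult_right)
  have i2: "integrable M (\<lambda>\<omega>. \<Sum>t<Suc k. s t * (w t \<omega> \<bullet> x t \<omega>))"
    using orth(1) by (intro Bochner_Integration.integrable_sum integrable_mult_right)
  have i3: "integrable M (\<lambda>\<omega>. B * norm (?W \<omega>))"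
    by (intro integrable_mult_right integrable_norm W_int)
  have R_int: "integrable M R"
    unfolding R_def by (intro Bochner_Integration.integrable_add Bochner_Integration.integrable_diff integrable_const i1 i2 i3)
  show int: "integrable M (\<lambda>\<omega>. gap X F (?xb \<omega>))"
  proof (rule Bochner_Integration.integrable_bound[OF _ gap_meas])
    show "integrable M (\<lambda>\<omega>. R \<omega> / ?S)" using R_int by simp
    show "AE \<omega> in M. norm (gap X F (?xb \<omega>)) \<le> norm (R \<omega> / ?S)"
      using le nonneg by (intro AE_I2) (metis abs_le_iff abs_of_nonneg dual_order.trans abs_ge_self real_norm_def)
  qed
  show "expectation (\<lambda>\<omega>. gap X F (?xb \<omega>)) \<ge> 0"
    using nonneg by (intro Bochner_Integration.integral_nonneg_AE AE_I2)
  have "expectation (\<lambda>\<omega>. gap X F (?xb \<omega>)) \<le> expectation (\<lambda>\<omega>. R \<omega> / ?S)"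
    using int R_int le by (intro integral_mono) auto
  also have "\<dots> = expectation R / ?S" by simp
  also have "expectation R = 2 * B\<^sup>2 * (s 0 / \<gamma> 0 + s k / \<gamma> k) + (\<Sum>t<Suc k. s t * expectation (q t))
      - (\<Sum>t<Suc k. s t * expectation (\<lambda>\<omega>. w t \<omega> \<bullet> x t \<omega>)) + B * expectation (\<lambda>\<omega>. norm (?W \<omega>))"
    unfolding R_def using i1 i2 i3 q_int orth(1)
    by (simp add: prob_space Bochner_Integration.integral_sum del: sum.lessThan_Suc)
  also have "\<dots> \<le> 2 * B\<^sup>2 * (s 0 / \<gamma> 0 + s k / \<gamma> k)
      + (\<Sum>t<Suc k. s t * (\<gamma> t * (C\<^sup>2 + (\<eta> t)\<^sup>2 * B\<^sup>2) + (2 * C * eps t + 2 * B\<^sup>2 * \<eta> t))) - 0 + B * ?K"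
    using q_le s W_le B_nonneg orth(2)
    by (intro add_mono diff_mono sum_mono mult_left_mono order_refl) (auto intro: less_imp_le simp del: sum.lessThan_Suc)
  finally show "expectation (\<lambda>\<omega>. gap X F (?xb \<omega>)) \<le>
      (2 * B\<^sup>2 * (s 0 / \<gamma> 0 + s k / \<gamma> k)
      + (\<Sum>t<Suc k. s t * (\<gamma> t * (C\<^sup>2 + (\<eta> t)\<^sup>2 * B\<^sup>2) + (2 * C * eps t + 2 * B\<^sup>2 * \<eta> t)))
      + 2 * B * C * sqrt (\<Sum>t<Suc k. (s t)\<^sup>2)) / ?S"
    using S by (simp add: divide_right_mono algebra_simps del: sum.lessThan_Suc)
qed

lemma gap_avg_tendsto_0:
  fixes r :: real
  defines "s \<equiv> \<lambda>t. \<gamma> t powr r"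
  assumes c: "incseq (\<lambda>t. s t / \<gamma> t) \<or> decseq (\<lambda>t. s t / \<gamma> t)"
    and S: "filterlim (\<lambda>k. \<Sum>t<k. s t) at_top sequentially"
    and quot: "(\<lambda>k. s k / \<gamma> k / (\<Sum>t<Suc k. s t)) \<longlonglongrightarrow> 0"
    and lims: "\<gamma> \<longlonglongrightarrow> 0" "\<eta> \<longlonglongrightarrow> 0" "eps \<longlonglongrightarrow> 0"
  shows "(\<lambda>k. expectation (\<lambda>\<omega>. gap X F (weighted_avg \<gamma> r x k \<omega>))) \<longlonglongrightarrow> 0"
proof -
  let ?S = "\<lambda>k. \<Sum>t<k. s t" and ?Q = "\<lambda>k. \<Sum>t<k. (s t)\<^sup>2"
  define e where "e t = \<gamma> t * (C\<^sup>2 + (\<eta> t)\<^sup>2 * B\<^sup>2) + (2 * C * eps t + 2 * B\<^sup>2 * \<eta> t)" for t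
  have s: "s t > 0" for t unfolding s_def using \<gamma>[of t] by simp
  have S0: "?S (Suc k) > 0" for k using s by (intro sum_pos) auto
  have "e \<longlonglongrightarrow> 0 * (C\<^sup>2 + 0\<^sup>2 * B\<^sup>2) + (2 * C * 0 + 2 * B\<^sup>2 * 0)"
    unfolding e_def using lims by (intro tendsto_intros)
  then have "e \<longlonglongrightarrow> 0" by simp
  then have e: "(\<lambda>k. (\<Sum>t<Suc k. s t * e t) / ?S (Suc k)) \<longlonglongrightarrow> 0"
    using weighted_average_tendsto_0[of s e] s S by (intro LIMSEQ_Suc) (auto intro: less_imp_le)
  \<comment> \<open>Multiplying the boundary quotient by the vanishing step size shows that no
    single weight dominates the total, as the noise estimate requires.\<close>
  have "(\<lambda>k. \<gamma> k * (s k / \<gamma> k / ?S (Suc k))) \<longlonglongrightarrow> 0 * 0"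
    using lims quot by (intro tendsto_mult)
  then have "(\<lambda>k. s k / ?S (Suc k)) \<longlonglongrightarrow> 0" using \<gamma> by (simp add: less_imp_neq[symmetric] del: sum.lessThan_Suc)
  then have "(\<lambda>k. sqrt (?Q k / (?S k)\<^sup>2)) \<longlonglongrightarrow> sqrt 0"
    using s S by (intro tendsto_real_sqrt sum_squares_over_square_sum_tendsto_0)
  then have "(\<lambda>k. sqrt (?Q k) / ?S k) \<longlonglongrightarrow> 0"
    using s by (simp add: real_sqrt_divide sum_nonneg less_imp_le)
  then have sq: "(\<lambda>k. sqrt (?Q (Suc k)) / ?S (Suc k)) \<longlonglongrightarrow> 0" by (rule LIMSEQ_Suc)
  have "filterlim (\<lambda>k. ?S (Suc k)) at_top sequentially"
    using filterlim_compose[OF S filterlim_Suc] .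
  then have c0: "(\<lambda>k. s 0 / \<gamma> 0 / ?S (Suc k)) \<longlonglongrightarrow> 0"
    by (intro real_tendsto_divide_at_top[OF tendsto_const])
  let ?b = "\<lambda>k. 2 * B\<^sup>2 * (s 0 / \<gamma> 0 / ?S (Suc k) + s k / \<gamma> k / ?S (Suc k))
      + (\<Sum>t<Suc k. s t * e t) / ?S (Suc k) + 2 * B * C * (sqrt (?Q (Suc k)) / ?S (Suc k))"
  have "?b \<longlonglongrightarrow> 2 * B\<^sup>2 * (0 + 0) + 0 + 2 * B * C * 0"
    using c0 quot e sq by (intro tendsto_intros)
  then have b: "?b \<longlonglongrightarrow> 0" by simp
  have "norm (expectation (\<lambda>\<omega>. gap X F (weighted_avg \<gamma> r x (Suc k) \<omega>))) \<le> ?b k" for k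
  proof -
    note g = gap_avg[OF c[unfolded s_def], of k]
    have "expectation (\<lambda>\<omega>. gap X F (weighted_avg \<gamma> r x (Suc k) \<omega>)) \<le> ?b k"
      using g(3) by (simp only: add_divide_distrib e_def s_def times_divide_eq_right distrib_left)
    then show ?thesis using g(2) by simp
  qed
  then have "(\<lambda>k. expectation (\<lambda>\<omega>. gap X F (weighted_avg \<gamma> r x (Suc k) \<omega>))) \<longlonglongrightarrow> 0"
    by (intro Lim_null_comparison[OF _ b]) simp
  \<comment> \<open>The dummy average at index 0 does not affect the limit.\<close>
  then show ?thesis by (rule LIMSEQ_imp_Suc)
qed

end

text \<open>Integrability accompanies the limit because the Bochner integral of a non-integrable
  function is 0, so the limit alone would not certify genuine expectations.\<close>

theorem lemma11:
  fixes X :: "(real ^ 'n) set"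
    and M :: "'w measure"
    and \<Phi> :: "real ^ 'n \<Rightarrow> real ^ 'd \<Rightarrow> real ^ 'n"
    and F :: "real ^ 'n \<Rightarrow> real ^ 'n"
    and \<xi>' :: "'w \<Rightarrow> real ^ 'd"
    and \<xi> :: "nat \<Rightarrow> 'w \<Rightarrow> real ^ 'd"
    and x z :: "nat \<Rightarrow> 'w \<Rightarrow> real ^ 'n"
    and \<gamma> \<eta> eps :: "nat \<Rightarrow> real"
    and \<epsilon> C \<gamma>\<^sub>0 \<eta>\<^sub>0 \<epsilon>\<^sub>0 a b c r :: real
  assumes "prob_space M"
    and X: "closed X" "bounded X" "convex X"
    and eps_bound: "\<epsilon> \<ge> 0" "\<And>k. eps k \<le> \<epsilon>"
    and \<xi>': "\<xi>' \<in> borel_measurable M"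
    and \<Phi>_meas: "(\<lambda>(y, u). \<Phi> y u) \<in>
           borel_measurable (restrict_space borel (enlarge X \<epsilon>) \<Otimes>\<^sub>M borel)"
    and F_eq: "\<And>y. y \<in> enlarge X \<epsilon> \<Longrightarrow> F y = prob_space.expectation M (\<lambda>\<omega>. \<Phi> y (\<xi>' \<omega>))"
    and F_mono: "monotone_map_on (enlarge X \<epsilon>) F"
    and F_cont: "continuous_on (enlarge X \<epsilon>) F"
    and C: "C > 0"
    and \<Phi>_bound: "\<And>y. y \<in> enlarge X \<epsilon> \<Longrightarrow>
           integrable M (\<lambda>\<omega>. (norm (\<Phi> y (\<xi>' \<omega>)))\<^sup>2) \<and>
           prob_space.expectation M (\<lambda>\<omega>. (norm (\<Phi> y (\<xi>' \<omega>)))\<^sup>2) \<le> C\<^sup>2"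
    and sol: "VI_solutions X F \<noteq> {}"
    and \<gamma>: "\<gamma>\<^sub>0 > 0" "\<And>k. \<gamma> k = \<gamma>\<^sub>0 * (real k + 1) powr (- a)"
    and \<eta>: "\<eta>\<^sub>0 \<ge> 0" "\<And>k. \<eta> k = \<eta>\<^sub>0 * (real k + 1) powr (- b)"
    and eps: "\<epsilon>\<^sub>0 \<ge> 0" "\<And>k. eps k = \<epsilon>\<^sub>0 * (real k + 1) powr (- c)"
    and \<xi>_indep: "prob_space.indep_vars M (\<lambda>_. borel) \<xi> UNIV"
    and \<xi>_distr: "\<And>j. distr M borel (\<xi> j) = distr M borel \<xi>'"
    and z_indep: "prob_space.indep_vars M (\<lambda>_. borel) z UNIV"
    and z_ball: "\<And>k \<omega>. \<omega> \<in> space M \<Longrightarrow> z k \<omega> \<in> cball 0 (eps k)"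
    and z_unif: "\<And>k. eps k > 0 \<Longrightarrow>
           distr M lborel (z k) = uniform_measure lborel (cball 0 (eps k))"
    and indep: "mutually_independent M (x 0) \<xi> z"
    and x0: "x 0 \<in> borel_measurable M" "\<And>\<omega>. \<omega> \<in> space M \<Longrightarrow> x 0 \<omega> \<in> X"
            "integrable M (\<lambda>\<omega>. (norm (x 0 \<omega>))\<^sup>2)"
    and x_step: "\<And>k \<omega>. \<omega> \<in> space M \<Longrightarrow>
           x (Suc k) \<omega> = closest_point X
             (x k \<omega> - \<gamma> k *\<^sub>R (\<Phi> (x k \<omega> + z k \<omega>) (\<xi> k \<omega>) + \<eta> k *\<^sub>R x k \<omega>))"
    and bc: "b > 0" "c > 0"
    and ar: "(a, r) \<in> {(u, v). 0 < u * v \<and> u * v \<le> 1 \<and> v \<ge> 1} \<union> {(u, v). 0 < u \<and> u < 1 \<and> v < 1}"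
  shows "(\<forall>k\<ge>1. integrable M (\<lambda>\<omega>. gap X F (weighted_avg \<gamma> r x k \<omega>))) \<and>
         (\<lambda>k. prob_space.expectation M (\<lambda>\<omega>. gap X F (weighted_avg \<gamma> r x k \<omega>))) \<longlonglongrightarrow> 0"
proof -
  interpret prob_space M by fact
  let ?E = "enlarge X \<epsilon>" and ?P = "distr M borel \<xi>'" and ?G = "history M (x 0) \<xi> z"
  obtain B where B: "\<And>y. y \<in> X \<Longrightarrow> norm y \<le> B"
    using X(2) by (auto simp: bounded_iff)
  \<comment> \<open>Any solution of the variational inequality is a point of
    \<open>X\<close>.\<close>
  have X_ne: "X \<noteq> {}" using sol by (auto simp: VI_solutions_def)
  have in_E: "y + u \<in> ?E" if "y \<in> X" "norm u \<le> \<epsilon>" for y u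
    using that unfolding enlarge_def by (intro set_plus_intro) simp_all
  have sec: "\<Phi> y \<in> borel_measurable borel" if "y \<in> ?E" for y
  proof -
    have "(\<lambda>u. (y, u)) \<in> measurable borel (restrict_space borel ?E \<Otimes>\<^sub>M borel)"
      using that by (intro measurable_Pair1') (simp add: space_restrict_space)
    from measurable_compose[OF this \<Phi>_meas] show ?thesis by simp
  qed
  have sec2: "(\<lambda>u. (norm (\<Phi> y u))\<^sup>2) \<in> borel_measurable borel" if "y \<in> ?E" for y
    using sec[OF that] by measurable
  have \<gamma>_pos: "\<gamma> t > 0" for t using \<gamma> by simp
  interpret A: stochastic_projection M X ?E \<Phi> F ?P \<xi> x z ?G \<gamma> \<eta> eps B C
  proof (rule stochastic_projection.intro[OF prob_space_axioms], rule stochastic_projection_axioms.intro)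
    show "X \<subseteq> ?E" using in_E[of _ 0] eps_bound by auto
    show "y + u \<in> ?E" if "y \<in> X" "norm u \<le> eps t" for t y u
      using in_E that eps_bound(2)[of t] by simp
    show "F y = (\<integral>u. \<Phi> y u \<partial>?P)" if "y \<in> ?E" for y
      using F_eq[OF that] by (subst integral_distr[OF \<xi>' sec[OF that]])
    show "integrable ?P (\<lambda>u. (norm (\<Phi> y u))\<^sup>2)" if "y \<in> ?E" for y
      using \<Phi>_bound[OF that] by (subst integrable_distr_eq[OF \<xi>' sec2[OF that]]) simp
    show "(\<integral>u. (norm (\<Phi> y u))\<^sup>2 \<partial>?P) \<le> C\<^sup>2" if "y \<in> ?E" for y
      using \<Phi>_bound[OF that] by (subst integral_distr[OF \<xi>' sec2[OF that]]) simp
    show "distr M borel (\<xi> t) = ?P" for t by (rule \<xi>_distr)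
    show "\<gamma> t > 0" for t by (rule \<gamma>_pos)
    show "indep_subalgebra M (?G t) borel (\<xi> t)" for t
      using indep \<xi>_indep by (rule indep_history)
    show "sets (?G t) \<subseteq> sets (?G (Suc t))" for t by (rule sets_history_mono)
    show "x 0 \<in> borel_measurable (?G 0)" by (rule history_measurable_init)
    show "z t \<in> borel_measurable (?G t)" for t by (rule history_measurable_z)
    show "\<xi> t \<in> borel_measurable (?G (Suc t))" for t by (rule history_measurable_\<xi>) simp
    show "norm (z t \<omega>) \<le> eps t" if "\<omega> \<in> space M" for t \<omega>
      using z_ball[OF that, of t] by simp
    show "\<eta> t \<ge> 0" for t using \<eta> by simp
    show "x (Suc t) \<omega> = closest_point X
        (x t \<omega> - \<gamma> t *\<^sub>R (\<Phi> (x t \<omega> + z t \<omega>) (\<xi> t \<omega>) + \<eta> t *\<^sub>R x t \<omega>))"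
      if "\<omega> \<in> space M" for t \<omega> using that by (rule x_step)
  qed (simp_all add: X X_ne B F_mono F_cont \<Phi>_meas C x0)
  \<comment> \<open>In the first region \<open>a > 0\<close> follows from \<open>a * r > 0\<close>
    and \<open>r \<ge> 1\<close>; in the second, \<open>a * r \<le> a < 1\<close>, also for negative
    \<open>r\<close>.\<close>
  have a: "a > 0" and ar_le: "a * r \<le> 1" and cases: "r \<ge> 1 \<and> a * r \<le> 1 \<or> r < 1 \<and> a < 1"
  proof -
    have "a > 0 \<and> a * r \<le> 1 \<and> (r \<ge> 1 \<and> a * r \<le> 1 \<or> r < 1 \<and> a < 1)"
    proof (cases "r \<ge> 1")
      case True
      then have "0 < a * r" "a * r \<le> 1" using ar by auto
      then show ?thesis using True by (auto simp: zero_less_mult_iff)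
    next
      case False
      then have "0 < a" "a < 1" using ar by auto
      moreover have "a * r \<le> a * 1" using False \<open>0 < a\<close> by (intro mult_left_mono) auto
      ultimately have "a * r \<le> 1" by linarith
      with \<open>0 < a\<close> \<open>a < 1\<close> False show ?thesis by simp
    qed
    then show "a > 0" "a * r \<le> 1" "r \<ge> 1 \<and> a * r \<le> 1 \<or> r < 1 \<and> a < 1" by auto
  qed
  have quot: "\<gamma> t powr r / \<gamma> t = \<gamma> t powr (r - 1)" for t
    using \<gamma>_pos[of t] by (simp add: powr_diff)
  have quot_eq: "\<gamma> t powr (r - 1) = \<gamma>\<^sub>0 powr (r - 1) * (real t + 1) powr (- (a * (r - 1)))" for t
    unfolding \<gamma>(2) by (rule step_size_powr[OF \<gamma>(1)])
  \<comment> \<open>The quotient is \<open>\<gamma> t powr (r - 1)\<close> with decreasing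
    \<open>\<gamma>\<close>, so the sign of \<open>r - 1\<close> decides the direction.\<close>
  have mono: "incseq (\<lambda>t. \<gamma> t powr r / \<gamma> t) \<or> decseq (\<lambda>t. \<gamma> t powr r / \<gamma> t)"
  proof (cases "r \<ge> 1")
    case True
    then have "decseq (\<lambda>t. \<gamma> t powr r / \<gamma> t)"
      unfolding quot quot_eq using a by (intro decseq_SucI mult_left_mono powr_mono2') auto
    then show ?thesis ..
  next
    case False
    then have "a * (r - 1) \<le> 0" using a by (intro mult_nonneg_nonpos) auto
    then have "incseq (\<lambda>t. \<gamma> t powr r / \<gamma> t)"
      unfolding quot quot_eq by (intro incseq_SucI mult_left_mono powr_mono2) auto
    then show ?thesis ..
  qed
  have \<gamma>_fun: "\<gamma> = (\<lambda>k. \<gamma>\<^sub>0 * (real k + 1) powr (- a))"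
    and \<eta>_fun: "\<eta> = (\<lambda>k. \<eta>\<^sub>0 * (real k + 1) powr (- b))"
    and eps_fun: "eps = (\<lambda>k. \<epsilon>\<^sub>0 * (real k + 1) powr (- c))"
    using \<gamma>(2) \<eta>(2) eps(2) by auto
  have "(\<lambda>k. expectation (\<lambda>\<omega>. gap X F (weighted_avg \<gamma> r x k \<omega>))) \<longlonglongrightarrow> 0"
  proof (rule A.gap_avg_tendsto_0[OF mono])
    show "filterlim (\<lambda>k. \<Sum>t<k. \<gamma> t powr r) at_top sequentially"
      unfolding \<gamma>(2) using \<gamma>(1) ar_le by (rule step_size_sum_at_top)
    show "(\<lambda>k. \<gamma> k powr r / \<gamma> k / (\<Sum>t<Suc k. \<gamma> t powr r)) \<longlonglongrightarrow> 0"
      unfolding quot unfolding \<gamma>(2) using \<gamma>(1) a cases by (rule step_size_quotient_tendsto_0)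
    show "\<gamma> \<longlonglongrightarrow> 0" unfolding \<gamma>_fun using a by (rule powr_neg_tendsto_0)
    show "\<eta> \<longlonglongrightarrow> 0" unfolding \<eta>_fun using bc(1) by (rule powr_neg_tendsto_0)
    show "eps \<longlonglongrightarrow> 0" unfolding eps_fun using bc(2) by (rule powr_neg_tendsto_0)
  qed
  moreover have "integrable M (\<lambda>\<omega>. gap X F (weighted_avg \<gamma> r x k \<omega>))" if "k \<ge> 1" for k
    using that A.gap_avg_integrable[OF mono] by (cases k) auto
  ultimately show ?thesis by blast
qed

end
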